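(* Let $Z$ be a scheme and let $A$ be an $\mathcal{O}_Z$-algebra that is locally free of rank four. Then $A$ is quaternion if and only if one can split the sheaf $A=\mathcal{O}_Z\oplus sA$ such that for every section $x\in sA$ we have $x^2\in\mathcal{O}_Z$. If $A$ is a quaternion algebra on an integral scheme $Z$, then the trace pairing $A\times A\to\mathcal{O}_Z$, $(x,y)\mapsto\mathrm{tr}(xy)$, is symmetric, so $A$ is Cayley–Hamilton of degree two.
   Context: All schemes are noetherian and over a field $k$ of characteristic not $2$. An $\mathcal{O}_Z$-algebra $A$ is quaternion if it is locally free of rank four and there is a linear trace function $\mathrm{tr}:A\to\mathcal{O}_Z$ such that (1) $\frac12\mathrm{tr}$ splits the natural inclusion $\mathcal{O}_Z\to A$, and (2) any section $a\in A$ satisfies a relation $a^2-\mathrm{tr}(a)a+g=0$ with $g\in\mathcal{O}_Z$. $A$ with trace $\mathrm{tr}$ is Cayley–Hamilton of degree two if $\mathrm{tr}$ is a linear map with $\mathrm{tr}(ab)=\mathrm{tr}(ba)$, $\mathrm{tr}(1)=2$, and every section $a$ satisfies $a^2-\mathrm{tr}(a)a+\frac12\left(\mathrm{tr}(a)^2-\mathrm{tr}(a^2)\right)=0$. *)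

theory Defs
  imports "HOL-Analysis.Abstract_Topology" "HOL-Algebra.Module" "HOL-Algebra.Ring_Divisibility"
begin

section \<open>Sheaves on a topological space\<close>

text \<open>The values of a (pre)sheaf on subsets that are not open are irrelevant throughout.
  The empty family covers the empty set, so the gluing condition forces a sheaf
  to have exactly one section over the empty set.\<close>

definition presheaf_of_sets ::
  "'p topology \<Rightarrow> ('p set \<Rightarrow> 'a set) \<Rightarrow> ('p set \<Rightarrow> 'p set \<Rightarrow> 'a \<Rightarrow> 'a) \<Rightarrow> bool" where
  "presheaf_of_sets T F res \<longleftrightarrow>
     (\<forall>U V. openin T U \<longrightarrow> openin T V \<longrightarrow> V \<subseteq> U \<longrightarrow> res U V \<in> F U \<rightarrow> F V) \<and>
     (\<forall>U. openin T U \<longrightarrow> (\<forall>s\<in>F U. res U U s = s)) \<and>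
     (\<forall>U V W. openin T U \<longrightarrow> openin T V \<longrightarrow> openin T W \<longrightarrow> W \<subseteq> V \<longrightarrow> V \<subseteq> U \<longrightarrow>
        (\<forall>s\<in>F U. res V W (res U V s) = res U W s))"

definition sheaf_of_sets ::
  "'p topology \<Rightarrow> ('p set \<Rightarrow> 'a set) \<Rightarrow> ('p set \<Rightarrow> 'p set \<Rightarrow> 'a \<Rightarrow> 'a) \<Rightarrow> bool" where
  "sheaf_of_sets T F res \<longleftrightarrow>
     presheaf_of_sets T F res \<and>
     (\<forall>\<C> s. (\<forall>V\<in>\<C>. openin T V \<and> s V \<in> F V) \<longrightarrow>
            (\<forall>V\<in>\<C>. \<forall>W\<in>\<C>. res V (V \<inter> W) (s V) = res W (V \<inter> W) (s W)) \<longrightarrow>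
            (\<exists>!t. t \<in> F (\<Union>\<C>) \<and> (\<forall>V\<in>\<C>. res (\<Union>\<C>) V t = s V)))"

section \<open>Ringed spaces and locally ringed spaces\<close>

record ('p, 'a) ringed_space =
  points :: "'p topology"
  sect :: "'p set \<Rightarrow> 'a ring"
  rest :: "'p set \<Rightarrow> 'p set \<Rightarrow> 'a \<Rightarrow> 'a"

definition ringed_space :: "('p, 'a) ringed_space \<Rightarrow> bool" where
  "ringed_space X \<longleftrightarrow>
     sheaf_of_sets (points X) (\<lambda>U. carrier (sect X U)) (rest X) \<and>
     (\<forall>U. openin (points X) U \<longrightarrow> cring (sect X U)) \<and>
     (\<forall>U V. openin (points X) U \<longrightarrow> openin (points X) V \<longrightarrow> V \<subseteq> U \<longrightarrow>
        rest X U V \<in> ring_hom (sect X U) (sect X V))"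

definition open_subspace :: "('p, 'a) ringed_space \<Rightarrow> 'p set \<Rightarrow> ('p, 'a) ringed_space" where
  "open_subspace X U = X\<lparr>points := subtopology (points X) U\<rparr>"

text \<open>The germ at \<open>x\<close> of a section is the class of all pairs (neighbourhood, section) agreeing
  with it near \<open>x\<close>. In the operations on a stalk, the unions range over representatives; all
  members of such a union coincide.\<close>

definition germ ::
  "('p, 'a) ringed_space \<Rightarrow> 'p \<Rightarrow> 'p set \<Rightarrow> 'a \<Rightarrow> ('p set \<times> 'a) set" where
  "germ X x U s =
     {(V, t). openin (points X) V \<and> x \<in> V \<and> t \<in> carrier (sect X V) \<and>
        (\<exists>W. openin (points X) W \<and> x \<in> W \<and> W \<subseteq> U \<inter> V \<and> rest X U W s = rest X V W t)}"

definition stalk :: "('p, 'a) ringed_space \<Rightarrow> 'p \<Rightarrow> ('p set \<times> 'a) set ring" where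
  "stalk X x =
     \<lparr>carrier = {germ X x U s | U s. openin (points X) U \<and> x \<in> U \<and> s \<in> carrier (sect X U)},
      mult = (\<lambda>G H. \<Union>(U, s)\<in>G. \<Union>(V, t)\<in>H.
        germ X x (U \<inter> V) (rest X U (U \<inter> V) s \<otimes>\<^bsub>sect X (U \<inter> V)\<^esub> rest X V (U \<inter> V) t)),
      one = germ X x (topspace (points X)) \<one>\<^bsub>sect X (topspace (points X))\<^esub>,
      zero = germ X x (topspace (points X)) \<zero>\<^bsub>sect X (topspace (points X))\<^esub>,
      add = (\<lambda>G H. \<Union>(U, s)\<in>G. \<Union>(V, t)\<in>H.
        germ X x (U \<inter> V) (rest X U (U \<inter> V) s \<oplus>\<^bsub>sect X (U \<inter> V)\<^esub> rest X V (U \<inter> V) t))\<rparr>"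

definition local_ring :: "('a, 'm) ring_scheme \<Rightarrow> bool" where
  "local_ring R \<longleftrightarrow> cring R \<and> (\<exists>!m. maximalideal m R)"

definition locally_ringed_space :: "('p, 'a) ringed_space \<Rightarrow> bool" where
  "locally_ringed_space X \<longleftrightarrow>
     ringed_space X \<and> (\<forall>x\<in>topspace (points X). local_ring (stalk X x))"

definition preim :: "('p, 'a) ringed_space \<Rightarrow> ('p \<Rightarrow> 'q) \<Rightarrow> 'q set \<Rightarrow> 'p set" where
  "preim X f V = {x \<in> topspace (points X). f x \<in> V}"

text \<open>A morphism consists of a continuous map \<open>f\<close> and comorphisms \<open>fs V\<close> from sections
  over \<open>V\<close> to sections over the preimage of \<open>V\<close>.\<close>

definition ringed_space_morphism ::
  "('p, 'a) ringed_space \<Rightarrow> ('q, 'c) ringed_space \<Rightarrow>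
   ('p \<Rightarrow> 'q) \<Rightarrow> ('q set \<Rightarrow> 'c \<Rightarrow> 'a) \<Rightarrow> bool" where
  "ringed_space_morphism X Y f fs \<longleftrightarrow>
     continuous_map (points X) (points Y) f \<and>
     (\<forall>V. openin (points Y) V \<longrightarrow> fs V \<in> ring_hom (sect Y V) (sect X (preim X f V))) \<and>
     (\<forall>U V. openin (points Y) U \<longrightarrow> openin (points Y) V \<longrightarrow> V \<subseteq> U \<longrightarrow>
        (\<forall>s\<in>carrier (sect Y U).
           fs V (rest Y U V s) = rest X (preim X f U) (preim X f V) (fs U s)))"

definition stalk_map ::
  "('p, 'a) ringed_space \<Rightarrow> ('p \<Rightarrow> 'q) \<Rightarrow> ('q set \<Rightarrow> 'c \<Rightarrow> 'a) \<Rightarrow> 'p \<Rightarrow>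
   ('q set \<times> 'c) set \<Rightarrow> ('p set \<times> 'a) set" where
  "stalk_map X f fs x G = (\<Union>(V, t)\<in>G. germ X x (preim X f V) (fs V t))"

definition local_hom ::
  "('a, 'm) ring_scheme \<Rightarrow> ('b, 'n) ring_scheme \<Rightarrow> ('a \<Rightarrow> 'b) \<Rightarrow> bool" where
  "local_hom R S h \<longleftrightarrow>
     h \<in> ring_hom R S \<and>
     (\<forall>m n. maximalideal m R \<longrightarrow> maximalideal n S \<longrightarrow> {r \<in> carrier R. h r \<in> n} = m)"

definition locally_ringed_space_morphism ::
  "('p, 'a) ringed_space \<Rightarrow> ('q, 'c) ringed_space \<Rightarrow>
   ('p \<Rightarrow> 'q) \<Rightarrow> ('q set \<Rightarrow> 'c \<Rightarrow> 'a) \<Rightarrow> bool" where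
  "locally_ringed_space_morphism X Y f fs \<longleftrightarrow>
     ringed_space_morphism X Y f fs \<and>
     (\<forall>x\<in>topspace (points X). local_hom (stalk Y (f x)) (stalk X x) (stalk_map X f fs x))"

text \<open>An isomorphism of ringed spaces induces isomorphisms on stalks, so locality is automatic.\<close>

definition ringed_space_iso ::
  "('p, 'a) ringed_space \<Rightarrow> ('q, 'c) ringed_space \<Rightarrow>
   ('p \<Rightarrow> 'q) \<Rightarrow> ('q set \<Rightarrow> 'c \<Rightarrow> 'a) \<Rightarrow> bool" where
  "ringed_space_iso X Y f fs \<longleftrightarrow>
     ringed_space_morphism X Y f fs \<and>
     homeomorphic_map (points X) (points Y) f \<and>
     (\<forall>V. openin (points Y) V \<longrightarrow> fs V \<in> ring_iso (sect Y V) (sect X (preim X f V)))"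

section \<open>Affine schemes\<close>

text \<open>\<open>loc_frac R p r s\<close> is the fraction \<open>r/s\<close> in the localisation of \<open>R\<close> at the prime ideal \<open>p\<close>,
  as a class of pairs (numerator, denominator).\<close>

definition loc_frac :: "('a, 'm) ring_scheme \<Rightarrow> 'a set \<Rightarrow> 'a \<Rightarrow> 'a \<Rightarrow> ('a \<times> 'a) set" where
  "loc_frac R p r s =
     {(r', s'). r' \<in> carrier R \<and> s' \<in> carrier R - p \<and>
        (\<exists>t\<in>carrier R - p. t \<otimes>\<^bsub>R\<^esub> (s' \<otimes>\<^bsub>R\<^esub> r) = t \<otimes>\<^bsub>R\<^esub> (s \<otimes>\<^bsub>R\<^esub> r'))}"

definition localisation :: "('a, 'm) ring_scheme \<Rightarrow> 'a set \<Rightarrow> ('a \<times> 'a) set ring" where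
  "localisation R p =
     \<lparr>carrier = {loc_frac R p r s | r s. r \<in> carrier R \<and> s \<in> carrier R - p},
      mult = (\<lambda>X Y. \<Union>(r, s)\<in>X. \<Union>(r', s')\<in>Y. loc_frac R p (r \<otimes>\<^bsub>R\<^esub> r') (s \<otimes>\<^bsub>R\<^esub> s')),
      one = loc_frac R p \<one>\<^bsub>R\<^esub> \<one>\<^bsub>R\<^esub>,
      zero = loc_frac R p \<zero>\<^bsub>R\<^esub> \<one>\<^bsub>R\<^esub>,
      add = (\<lambda>X Y. \<Union>(r, s)\<in>X. \<Union>(r', s')\<in>Y.
        loc_frac R p ((s' \<otimes>\<^bsub>R\<^esub> r) \<oplus>\<^bsub>R\<^esub> (s \<otimes>\<^bsub>R\<^esub> r')) (s \<otimes>\<^bsub>R\<^esub> s'))\<rparr>"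

definition zariski_open :: "('a, 'm) ring_scheme \<Rightarrow> 'a set set \<Rightarrow> bool" where
  "zariski_open R U \<longleftrightarrow> (\<exists>I. ideal I R \<and> U = {p. primeideal p R \<and> \<not> I \<subseteq> p})"

definition zariski_topology :: "('a, 'm) ring_scheme \<Rightarrow> 'a set topology" where
  "zariski_topology R = topology (zariski_open R)"

lemma zariski_open_iff_subset:
  assumes "cring R"
  shows "zariski_open R U \<longleftrightarrow> (\<exists>E\<subseteq>carrier R. U = {p. primeideal p R \<and> \<not> E \<subseteq> p})"
proof
  assume "zariski_open R U"
  then obtain I where "ideal I R" "U = {p. primeideal p R \<and> \<not> I \<subseteq> p}"
    unfolding zariski_open_def by blast
  moreover have "I \<subseteq> carrier R"
    using \<open>ideal I R\<close> by (simp add: additive_subgroup.a_subset ideal.axioms(1))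
  ultimately show "\<exists>E\<subseteq>carrier R. U = {p. primeideal p R \<and> \<not> E \<subseteq> p}" by blast
next
  assume "\<exists>E\<subseteq>carrier R. U = {p. primeideal p R \<and> \<not> E \<subseteq> p}"
  then obtain E where E: "E \<subseteq> carrier R" "U = {p. primeideal p R \<and> \<not> E \<subseteq> p}" by blast
  interpret cring R by fact
  have "Idl\<^bsub>R\<^esub> E \<subseteq> p \<longleftrightarrow> E \<subseteq> p" if "primeideal p R" for p
    using that E(1) Idl_subset_ideal primeideal.axioms(1) by blast
  then have "U = {p. primeideal p R \<and> \<not> Idl\<^bsub>R\<^esub> E \<subseteq> p}" unfolding E(2) by (intro Collect_cong) blast
  then show "zariski_open R U"
    unfolding zariski_open_def using genideal_ideal[OF E(1)] by blast
qed

lemma istopology_zariski_open: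
  assumes "cring R"
  shows "istopology (zariski_open R)"
  unfolding istopology_def
proof (intro conjI allI impI)
  interpret cring R by fact
  fix S T assume "zariski_open R S" "zariski_open R T"
  then obtain I J where I: "ideal I R" "S = {p. primeideal p R \<and> \<not> I \<subseteq> p}"
    and J: "ideal J R" "T = {p. primeideal p R \<and> \<not> J \<subseteq> p}"
    unfolding zariski_open_def by blast
  have "\<not> I \<inter> J \<subseteq> p" if p: "primeideal p R" and "\<not> I \<subseteq> p" "\<not> J \<subseteq> p" for p
  proof -
    obtain a b where ab: "a \<in> I" "a \<notin> p" "b \<in> J" "b \<notin> p"
      using \<open>\<not> I \<subseteq> p\<close> \<open>\<not> J \<subseteq> p\<close> by blast
    have c: "a \<in> carrier R" "b \<in> carrier R"
      using ideal.Icarr[OF I(1) ab(1)] ideal.Icarr[OF J(1) ab(3)] by simp_all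
    then have "a \<otimes>\<^bsub>R\<^esub> b \<in> I \<inter> J"
      using ideal.I_r_closed[OF I(1) ab(1)] ideal.I_l_closed[OF J(1) ab(3)] by simp
    moreover have "a \<otimes>\<^bsub>R\<^esub> b \<notin> p"
      using ab(2,4) primeideal.I_prime[OF p c] by metis
    ultimately show ?thesis by blast
  qed
  then have "primeideal p R \<and> \<not> I \<inter> J \<subseteq> p \<longleftrightarrow>
      primeideal p R \<and> \<not> I \<subseteq> p \<and> \<not> J \<subseteq> p" for p
    by (metis inf.coboundedI1 inf.coboundedI2)
  then have "S \<inter> T = {p. primeideal p R \<and> \<not> I \<inter> J \<subseteq> p}"
    unfolding I(2) J(2) by auto
  then show "zariski_open R (S \<inter> T)"
    unfolding zariski_open_def using i_intersect[OF I(1) J(1)] by blast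
next
  fix \<K> assume "\<forall>K\<in>\<K>. zariski_open R K"
  then have "\<forall>K\<in>\<K>. \<exists>E\<subseteq>carrier R. K = {p. primeideal p R \<and> \<not> E \<subseteq> p}"
    using zariski_open_iff_subset[OF assms] by simp
  from bchoice[OF this] obtain E where "\<forall>K\<in>\<K>. E K \<subseteq> carrier R \<and>
      K = {p. primeideal p R \<and> \<not> E K \<subseteq> p}" by blast
  then have E: "E K \<subseteq> carrier R" "p \<in> K \<longleftrightarrow> primeideal p R \<and> \<not> E K \<subseteq> p"
    if "K \<in> \<K>" for K p
    using that by auto
  have "\<Union>\<K> = {p. primeideal p R \<and> \<not> (\<Union>K\<in>\<K>. E K) \<subseteq> p}"
    using E(2) by (auto simp only: UN_subset_iff Union_iff mem_Collect_eq)
  moreover have "(\<Union>K\<in>\<K>. E K) \<subseteq> carrier R" using E(1) by blast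
  ultimately show "zariski_open R (\<Union>\<K>)"
    unfolding zariski_open_iff_subset[OF assms] by blast
qed

text \<open>Sections of the structure sheaf over \<open>U\<close> are the functions assigning to each \<open>p\<close> in \<open>U\<close>
  an element of the localisation at \<open>p\<close> that are locally given by a single fraction.\<close>

definition Spec_sections ::
  "('a, 'm) ring_scheme \<Rightarrow> 'a set set \<Rightarrow> ('a set \<Rightarrow> ('a \<times> 'a) set) set" where
  "Spec_sections R U =
     {s \<in> (\<Pi>\<^sub>E p\<in>U. carrier (localisation R p)).
        \<forall>p\<in>U. \<exists>V a b. openin (zariski_topology R) V \<and> p \<in> V \<and> V \<subseteq> U \<and>
          a \<in> carrier R \<and> b \<in> carrier R \<and> (\<forall>q\<in>V. b \<notin> q \<and> s q = loc_frac R q a b)}"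

definition Spec ::
  "('a, 'm) ring_scheme \<Rightarrow> ('a set, 'a set \<Rightarrow> ('a \<times> 'a) set) ringed_space" where
  "Spec R =
     \<lparr>points = zariski_topology R,
      sect = (\<lambda>U. \<lparr>carrier = Spec_sections R U,
        mult = (\<lambda>s t. \<lambda>p\<in>U. s p \<otimes>\<^bsub>localisation R p\<^esub> t p),
        one = (\<lambda>p\<in>U. \<one>\<^bsub>localisation R p\<^esub>),
        zero = (\<lambda>p\<in>U. \<zero>\<^bsub>localisation R p\<^esub>),
        add = (\<lambda>s t. \<lambda>p\<in>U. s p \<oplus>\<^bsub>localisation R p\<^esub> t p)\<rparr>),
      rest = (\<lambda>U V s. restrict s V)\<rparr>"

section \<open>Schemes\<close>

text \<open>If an open subspace is isomorphic to the spectrum of a ring, that ring is isomorphic to its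
  ring of sections, so it is no restriction to take the ring over the same type \<open>'a\<close>.\<close>

definition is_Spec_of :: "('p, 'a) ringed_space \<Rightarrow> 'a ring \<Rightarrow> bool" where
  "is_Spec_of X R \<longleftrightarrow> cring R \<and> (\<exists>f fs. ringed_space_iso X (Spec R) f fs)"

definition scheme :: "('p, 'a) ringed_space \<Rightarrow> bool" where
  "scheme X \<longleftrightarrow>
     locally_ringed_space X \<and>
     (\<forall>x\<in>topspace (points X). \<exists>U. openin (points X) U \<and> x \<in> U \<and>
        (\<exists>R. is_Spec_of (open_subspace X U) R))"

definition noetherian_scheme :: "('p, 'a) ringed_space \<Rightarrow> bool" where
  "noetherian_scheme X \<longleftrightarrow>
     scheme X \<and> compact_space (points X) \<and>
     (\<forall>x\<in>topspace (points X). \<exists>U. openin (points X) U \<and> x \<in> U \<and>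
        (\<exists>R. noetherian_ring R \<and> is_Spec_of (open_subspace X U) R))"

definition integral_scheme :: "('p, 'a) ringed_space \<Rightarrow> bool" where
  "integral_scheme X \<longleftrightarrow>
     scheme X \<and> topspace (points X) \<noteq> {} \<and>
     (\<forall>U. openin (points X) U \<longrightarrow> U \<noteq> {} \<longrightarrow> domain (sect X U))"

definition scheme_over_field ::
  "('k, 'm) ring_scheme \<Rightarrow> ('p, 'a) ringed_space \<Rightarrow>
   ('p \<Rightarrow> 'k set) \<Rightarrow> ('k set set \<Rightarrow> ('k set \<Rightarrow> ('k \<times> 'k) set) \<Rightarrow> 'a) \<Rightarrow> bool" where
  "scheme_over_field K X f fs \<longleftrightarrow>
     field K \<and> scheme X \<and> locally_ringed_space_morphism X (Spec K) f fs"

section \<open>Sheaves of modules and algebras\<close>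

record ('p, 'a, 'b) module_sheaf =
  msect :: "'p set \<Rightarrow> ('a, 'b) module"
  mrest :: "'p set \<Rightarrow> 'p set \<Rightarrow> 'b \<Rightarrow> 'b"

definition sheaf_of_modules ::
  "('p, 'a) ringed_space \<Rightarrow> ('p, 'a, 'b) module_sheaf \<Rightarrow> bool" where
  "sheaf_of_modules X M \<longleftrightarrow>
     sheaf_of_sets (points X) (\<lambda>U. carrier (msect M U)) (mrest M) \<and>
     (\<forall>U. openin (points X) U \<longrightarrow> module (sect X U) (msect M U)) \<and>
     (\<forall>U V. openin (points X) U \<longrightarrow> openin (points X) V \<longrightarrow> V \<subseteq> U \<longrightarrow>
        (\<forall>a\<in>carrier (msect M U). \<forall>b\<in>carrier (msect M U).
           mrest M U V (a \<oplus>\<^bsub>msect M U\<^esub> b) = mrest M U V a \<oplus>\<^bsub>msect M V\<^esub> mrest M U V b) \<and>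
        (\<forall>r\<in>carrier (sect X U). \<forall>a\<in>carrier (msect M U).
           mrest M U V (r \<odot>\<^bsub>msect M U\<^esub> a) = rest X U V r \<odot>\<^bsub>msect M V\<^esub> mrest M U V a))"

text \<open>Associative and unital, but not necessarily commutative.\<close>

definition sheaf_of_algebras ::
  "('p, 'a) ringed_space \<Rightarrow> ('p, 'a, 'b) module_sheaf \<Rightarrow> bool" where
  "sheaf_of_algebras X A \<longleftrightarrow>
     sheaf_of_modules X A \<and>
     (\<forall>U. openin (points X) U \<longrightarrow> ring (msect A U) \<and>
        (\<forall>r\<in>carrier (sect X U). \<forall>a\<in>carrier (msect A U). \<forall>b\<in>carrier (msect A U).
           (r \<odot>\<^bsub>msect A U\<^esub> a) \<otimes>\<^bsub>msect A U\<^esub> b = r \<odot>\<^bsub>msect A U\<^esub> (a \<otimes>\<^bsub>msect A U\<^esub> b) \<and>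
           a \<otimes>\<^bsub>msect A U\<^esub> (r \<odot>\<^bsub>msect A U\<^esub> b) = r \<odot>\<^bsub>msect A U\<^esub> (a \<otimes>\<^bsub>msect A U\<^esub> b))) \<and>
     (\<forall>U V. openin (points X) U \<longrightarrow> openin (points X) V \<longrightarrow> V \<subseteq> U \<longrightarrow>
        mrest A U V \<in> ring_hom (msect A U) (msect A V))"

definition module_sheaf_hom ::
  "('p, 'a) ringed_space \<Rightarrow> ('p, 'a, 'b) module_sheaf \<Rightarrow> ('p, 'a, 'c) module_sheaf \<Rightarrow>
   ('p set \<Rightarrow> 'b \<Rightarrow> 'c) \<Rightarrow> bool" where
  "module_sheaf_hom X M N h \<longleftrightarrow>
     (\<forall>U. openin (points X) U \<longrightarrow>
        h U \<in> carrier (msect M U) \<rightarrow> carrier (msect N U) \<and>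
        (\<forall>a\<in>carrier (msect M U). \<forall>b\<in>carrier (msect M U).
           h U (a \<oplus>\<^bsub>msect M U\<^esub> b) = h U a \<oplus>\<^bsub>msect N U\<^esub> h U b) \<and>
        (\<forall>r\<in>carrier (sect X U). \<forall>a\<in>carrier (msect M U).
           h U (r \<odot>\<^bsub>msect M U\<^esub> a) = r \<odot>\<^bsub>msect N U\<^esub> h U a)) \<and>
     (\<forall>U V. openin (points X) U \<longrightarrow> openin (points X) V \<longrightarrow> V \<subseteq> U \<longrightarrow>
        (\<forall>a\<in>carrier (msect M U). h V (mrest M U V a) = mrest N U V (h U a)))"

definition module_sheaf_iso ::
  "('p, 'a) ringed_space \<Rightarrow> ('p, 'a, 'b) module_sheaf \<Rightarrow> ('p, 'a, 'c) module_sheaf \<Rightarrow>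
   ('p set \<Rightarrow> 'b \<Rightarrow> 'c) \<Rightarrow> bool" where
  "module_sheaf_iso X M N h \<longleftrightarrow>
     module_sheaf_hom X M N h \<and>
     (\<forall>U. openin (points X) U \<longrightarrow> bij_betw (h U) (carrier (msect M U)) (carrier (msect N U)))"

definition structure_module :: "('p, 'a) ringed_space \<Rightarrow> ('p, 'a, 'a) module_sheaf" where
  "structure_module X =
     \<lparr>msect = (\<lambda>U. \<lparr>carrier = carrier (sect X U), mult = mult (sect X U),
        one = \<one>\<^bsub>sect X U\<^esub>, zero = \<zero>\<^bsub>sect X U\<^esub>, add = add (sect X U),
        smult = mult (sect X U)\<rparr>),
      mrest = rest X\<rparr>"

text \<open>The fields \<open>mult\<close> and \<open>one\<close> of the free module only fill the record and are not used.\<close>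

definition free_module_sheaf ::
  "('p, 'a) ringed_space \<Rightarrow> nat \<Rightarrow> ('p, 'a, nat \<Rightarrow> 'a) module_sheaf" where
  "free_module_sheaf X n =
     \<lparr>msect = (\<lambda>U. \<lparr>carrier = {..<n} \<rightarrow>\<^sub>E carrier (sect X U),
        mult = (\<lambda>x y. \<lambda>i\<in>{..<n}. x i \<otimes>\<^bsub>sect X U\<^esub> y i),
        one = (\<lambda>i\<in>{..<n}. \<one>\<^bsub>sect X U\<^esub>),
        zero = (\<lambda>i\<in>{..<n}. \<zero>\<^bsub>sect X U\<^esub>),
        add = (\<lambda>x y. \<lambda>i\<in>{..<n}. x i \<oplus>\<^bsub>sect X U\<^esub> y i),
        smult = (\<lambda>r x. \<lambda>i\<in>{..<n}. r \<otimes>\<^bsub>sect X U\<^esub> x i)\<rparr>),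
      mrest = (\<lambda>U V x. \<lambda>i\<in>{..<n}. rest X U V (x i))\<rparr>"

definition locally_free_of_rank ::
  "('p, 'a) ringed_space \<Rightarrow> ('p, 'a, 'b) module_sheaf \<Rightarrow> nat \<Rightarrow> bool" where
  "locally_free_of_rank X M n \<longleftrightarrow>
     (\<forall>x\<in>topspace (points X). \<exists>U. openin (points X) U \<and> x \<in> U \<and>
        (\<exists>h. module_sheaf_iso (open_subspace X U) (free_module_sheaf X n) M h))"

definition submodule_sheaf ::
  "('p, 'a) ringed_space \<Rightarrow> ('p, 'a, 'b) module_sheaf \<Rightarrow> ('p set \<Rightarrow> 'b set) \<Rightarrow> bool" where
  "submodule_sheaf X M S \<longleftrightarrow>
     (\<forall>U. openin (points X) U \<longrightarrow> submodule (S U) (sect X U) (msect M U)) \<and>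
     sheaf_of_sets (points X) S (mrest M)"

section \<open>Quaternion algebras, splittings and Cayley--Hamilton algebras\<close>

text \<open>The inclusion of the structure sheaf into an algebra.\<close>

definition alg_unit :: "('p, 'a, 'b) module_sheaf \<Rightarrow> 'p set \<Rightarrow> 'a \<Rightarrow> 'b" where
  "alg_unit A U f = f \<odot>\<^bsub>msect A U\<^esub> \<one>\<^bsub>msect A U\<^esub>"

definition half :: "('a, 'm) ring_scheme \<Rightarrow> 'a" where
  "half R = inv\<^bsub>R\<^esub> (\<one>\<^bsub>R\<^esub> \<oplus>\<^bsub>R\<^esub> \<one>\<^bsub>R\<^esub>)"

definition quaternion_trace ::
  "('p, 'a) ringed_space \<Rightarrow> ('p, 'a, 'b) module_sheaf \<Rightarrow> ('p set \<Rightarrow> 'b \<Rightarrow> 'a) \<Rightarrow> bool" where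
  "quaternion_trace Z A tr \<longleftrightarrow>
     module_sheaf_hom Z A (structure_module Z) tr \<and>
     (\<forall>U. openin (points Z) U \<longrightarrow>
        (\<forall>f\<in>carrier (sect Z U). half (sect Z U) \<otimes>\<^bsub>sect Z U\<^esub> tr U (alg_unit A U f) = f) \<and>
        (\<forall>a\<in>carrier (msect A U). \<exists>g\<in>carrier (sect Z U).
           ((a \<otimes>\<^bsub>msect A U\<^esub> a) \<ominus>\<^bsub>msect A U\<^esub> (tr U a \<odot>\<^bsub>msect A U\<^esub> a))
             \<oplus>\<^bsub>msect A U\<^esub> alg_unit A U g = \<zero>\<^bsub>msect A U\<^esub>))"

definition quaternion ::
  "('p, 'a) ringed_space \<Rightarrow> ('p, 'a, 'b) module_sheaf \<Rightarrow> bool" where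
  "quaternion Z A \<longleftrightarrow>
     sheaf_of_algebras Z A \<and> locally_free_of_rank Z A 4 \<and> (\<exists>tr. quaternion_trace Z A tr)"

text \<open>\<open>A\<close> is the direct sum of the structure sheaf, embedded by \<open>alg_unit\<close>, and the subsheaf of
  modules \<open>S\<close>. Sections of a finite direct sum of sheaves of modules are computed openwise.\<close>

definition splits_off_structure_sheaf ::
  "('p, 'a) ringed_space \<Rightarrow> ('p, 'a, 'b) module_sheaf \<Rightarrow> ('p set \<Rightarrow> 'b set) \<Rightarrow> bool" where
  "splits_off_structure_sheaf Z A S \<longleftrightarrow>
     submodule_sheaf Z A S \<and>
     (\<forall>U. openin (points Z) U \<longrightarrow>
        bij_betw (\<lambda>(f, x). alg_unit A U f \<oplus>\<^bsub>msect A U\<^esub> x)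
          (carrier (sect Z U) \<times> S U) (carrier (msect A U)))"

definition trace_pairing ::
  "('p, 'a, 'b) module_sheaf \<Rightarrow> ('p set \<Rightarrow> 'b \<Rightarrow> 'a) \<Rightarrow> 'p set \<Rightarrow> 'b \<Rightarrow> 'b \<Rightarrow> 'a" where
  "trace_pairing A tr U x y = tr U (x \<otimes>\<^bsub>msect A U\<^esub> y)"

definition cayley_hamilton_degree_two ::
  "('p, 'a) ringed_space \<Rightarrow> ('p, 'a, 'b) module_sheaf \<Rightarrow> ('p set \<Rightarrow> 'b \<Rightarrow> 'a) \<Rightarrow> bool" where
  "cayley_hamilton_degree_two Z A tr \<longleftrightarrow>
     module_sheaf_hom Z A (structure_module Z) tr \<and>
     (\<forall>U. openin (points Z) U \<longrightarrow>
        (\<forall>a\<in>carrier (msect A U). \<forall>b\<in>carrier (msect A U).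
           tr U (a \<otimes>\<^bsub>msect A U\<^esub> b) = tr U (b \<otimes>\<^bsub>msect A U\<^esub> a)) \<and>
        tr U \<one>\<^bsub>msect A U\<^esub> = \<one>\<^bsub>sect Z U\<^esub> \<oplus>\<^bsub>sect Z U\<^esub> \<one>\<^bsub>sect Z U\<^esub> \<and>
        (\<forall>a\<in>carrier (msect A U).
           ((a \<otimes>\<^bsub>msect A U\<^esub> a) \<ominus>\<^bsub>msect A U\<^esub> (tr U a \<odot>\<^bsub>msect A U\<^esub> a))
             \<oplus>\<^bsub>msect A U\<^esub> alg_unit A U (half (sect Z U) \<otimes>\<^bsub>sect Z U\<^esub>
               ((tr U a \<otimes>\<^bsub>sect Z U\<^esub> tr U a) \<ominus>\<^bsub>sect Z U\<^esub> tr U (a \<otimes>\<^bsub>msect A U\<^esub> a)))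
             = \<zero>\<^bsub>msect A U\<^esub>))"

end

(* Halving the trace splits the structure sheaf off A with the traceless sections as complement;
   conversely a splitting A = O + S whose summand S has scalar squares has the trace
   tr (f + x) = 2 f.

   For the symmetry of the trace pairing put D = ab - ba. The quadratic relation for a gives
   aD + Da = [a^2, b] = tr(a) D, while its polarisation gives aD + Da = tr(a) D + tr(D) a modulo
   scalars, so tr(D) a is a scalar. Hence tr(D) D = [tr(D) a, b] = 0, and taking traces
   tr(D)^2 = 0, so tr(D) = 0 over a domain. *)
theory Submission
  imports Defs
begin

text \<open>The constant terms of the quadratic relations are only known to exist. Commutators are
  used because scalars are central, so these unknown terms drop out of them. The pair to polarise is
  a and D, since the number to be killed, tr(D), then appears as the coefficient of a. The explicit
  constant demanded by Cayley-Hamilton is recovered from the unknown one by applying the trace to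
  the relation and halving.

  Halving itself needs care: the characteristic is restricted only for \<open>K\<close>, whereas
  \<open>half\<close> is an inverse in each ring of sections and is meaningful only if 1 + 1 is a
  unit there. So an inverse of 1 + 1 is exhibited among the global sections of the spectrum of
  \<open>K\<close> and carried to every open set of \<open>Z\<close>.

  The rest is algebra over one open set at a time. What remains for sheaves is that being traceless
  is a local condition, that the decomposition of a section is compatible with restriction, and that
  the empty open set, where the ring of sections is zero and not a domain, is treated
  separately.\<close>

section \<open>Invertibility of two over a field\<close>

text \<open>Ring homomorphisms preserve the equation 2u = 1. The source is asked only to contain 1,
  1 + 1 and \<open>u\<close>, so the sections over the spectrum of \<open>K\<close> can be inserted
  without first showing that they form a ring.\<close>

lemma two_Units_ring_hom:
  assumes h: "h \<in> ring_hom R S" and S: "cring S"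
    and c: "\<one>\<^bsub>R\<^esub> \<in> carrier R" "\<one>\<^bsub>R\<^esub> \<oplus>\<^bsub>R\<^esub> \<one>\<^bsub>R\<^esub> \<in> carrier R" "u \<in> carrier R"
    and u: "(\<one>\<^bsub>R\<^esub> \<oplus>\<^bsub>R\<^esub> \<one>\<^bsub>R\<^esub>) \<otimes>\<^bsub>R\<^esub> u = \<one>\<^bsub>R\<^esub>"
  shows "\<one>\<^bsub>S\<^esub> \<oplus>\<^bsub>S\<^esub> \<one>\<^bsub>S\<^esub> \<in> Units S"
proof -
  interpret S: cring S by (rule S)
  have "h u \<in> carrier S" using h c(3) by (rule ring_hom_closed)
  moreover have "h (\<one>\<^bsub>R\<^esub> \<oplus>\<^bsub>R\<^esub> \<one>\<^bsub>R\<^esub>) = \<one>\<^bsub>S\<^esub> \<oplus>\<^bsub>S\<^esub> \<one>\<^bsub>S\<^esub>"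
    using ring_hom_add[OF h c(1) c(1)] ring_hom_one[OF h] by simp
  then have "(\<one>\<^bsub>S\<^esub> \<oplus>\<^bsub>S\<^esub> \<one>\<^bsub>S\<^esub>) \<otimes>\<^bsub>S\<^esub> h u = \<one>\<^bsub>S\<^esub>"
    using ring_hom_mult[OF h c(2,3)] ring_hom_one[OF h] u by simp
  moreover from calculation have "h u \<otimes>\<^bsub>S\<^esub> (\<one>\<^bsub>S\<^esub> \<oplus>\<^bsub>S\<^esub> \<one>\<^bsub>S\<^esub>) = \<one>\<^bsub>S\<^esub>"
    by (simp add: S.m_comm)
  ultimately show ?thesis unfolding Units_def by blast
qed

section \<open>Constant fractions as sections over the spectrum of a field\<close>

lemma openin_zariski_topology:
  "cring R \<Longrightarrow> openin (zariski_topology R) = zariski_open R"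
  by (simp add: zariski_topology_def istopology_zariski_open topology_inverse')

lemma mem_topspace_zariski:
  assumes "cring R" "p \<in> topspace (zariski_topology R)"
  shows "primeideal p R"
  using assms openin_topspace[of "zariski_topology R"]
  by (auto simp: openin_zariski_topology zariski_open_def)

lemma constant_fraction_section:
  assumes "cring R" "openin (zariski_topology R) V" "a \<in> carrier R" "b \<in> carrier R"
    and "\<And>p. p \<in> V \<Longrightarrow> b \<notin> p"
  shows "(\<lambda>p\<in>V. loc_frac R p a b) \<in> Spec_sections R V"
proof -
  have "loc_frac R p a b \<in> carrier (localisation R p)" if "p \<in> V" for p
    using assms that by (auto simp: localisation_def)
  moreover have "\<exists>W a' b'. openin (zariski_topology R) W \<and> p \<in> W \<and> W \<subseteq> V \<and>
      a' \<in> carrier R \<and> b' \<in> carrier R \<and>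
      (\<forall>q\<in>W. b' \<notin> q \<and> (\<lambda>p\<in>V. loc_frac R p a b) q = loc_frac R q a' b')" if "p \<in> V" for p
    using assms that by (intro exI[of _ V] exI[of _ a] exI[of _ b]) simp
  ultimately show ?thesis by (simp add: Spec_sections_def)
qed

text \<open>The operations of \<open>localisation\<close> are unions over all representatives of
  both classes; such a union is evaluated by showing that each pair of representatives contributes
  the same class.\<close>

lemma UN_pairs_constant:
  assumes "X \<noteq> {}" "Y \<noteq> {}"
    and "\<And>r s r' s'. (r, s) \<in> X \<Longrightarrow> (r', s') \<in> Y \<Longrightarrow> F r s r' s' = C"
  shows "(\<Union>(r, s)\<in>X. \<Union>(r', s')\<in>Y. F r s r' s') = C"
proof -
  have "(case z of (r, s) \<Rightarrow> \<Union>(r', s')\<in>Y. F r s r' s') = C" if "z \<in> X" for z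
  proof (cases z)
    case (Pair r s)
    have "(case w of (r', s') \<Rightarrow> F r s r' s') = C" if "w \<in> Y" for w
      using assms(3) \<open>z \<in> X\<close> that Pair by (cases w) simp
    then show ?thesis using assms(2) Pair by simp
  qed
  then show ?thesis using assms(1) by simp
qed

context field
begin

text \<open>An element outside a prime ideal is nonzero, so in a field the factor \<open>t\<close>
  in \<open>loc_frac\<close> cancels; in the other direction \<open>t\<close> = 1 serves. Equality
  of fractions becomes plain cross-multiplication.\<close>

lemma mem_loc_frac_iff:
  assumes p: "primeideal p R" and "r \<in> carrier R" "s \<in> carrier R - p"
  shows "(r', s') \<in> loc_frac R p r s \<longleftrightarrow>
    r' \<in> carrier R \<and> s' \<in> carrier R - p \<and> s' \<otimes> r = s \<otimes> r'"
proof -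
  interpret p: primeideal p R by (rule p)
  have nz: "t \<noteq> \<zero>" if "t \<in> carrier R - p" for t
    using that p.zero_closed by blast
  have "\<one> \<in> carrier R - p"
    using p.one_imp_carrier p.I_notcarr by blast
  then have "(\<exists>t\<in>carrier R - p. t \<otimes> (s' \<otimes> r) = t \<otimes> (s \<otimes> r')) \<longleftrightarrow> s' \<otimes> r = s \<otimes> r'"
    if "r' \<in> carrier R" "s' \<in> carrier R"
    using that assms(2,3) m_lcancel nz by auto
  then show ?thesis by (auto simp: loc_frac_def)
qed

lemma loc_frac_cong:
  assumes p: "primeideal p R" and "r \<in> carrier R" "s \<in> carrier R - p"
    and "r' \<in> carrier R" "s' \<in> carrier R - p" and eq: "s' \<otimes> r = s \<otimes> r'"
  shows "loc_frac R p r s = loc_frac R p r' s'"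
proof -
  interpret p: primeideal p R by (rule p)
  have nz: "s \<noteq> \<zero>" "s' \<noteq> \<zero>" using assms(3,5) p.zero_closed by blast+
  have "y \<otimes> r = s \<otimes> x \<longleftrightarrow> y \<otimes> r' = s' \<otimes> x" if "x \<in> carrier R" "y \<in> carrier R" for x y
  proof -
    have "y \<otimes> r = s \<otimes> x \<longleftrightarrow> s' \<otimes> (y \<otimes> r) = s' \<otimes> (s \<otimes> x)"
      using that assms nz m_lcancel by auto
    also have "\<dots> \<longleftrightarrow> y \<otimes> (s' \<otimes> r) = s \<otimes> (s' \<otimes> x)"
      using that assms by (simp add: m_lcomm[of s' y r] m_lcomm[of s' s x])
    also have "\<dots> \<longleftrightarrow> s \<otimes> (y \<otimes> r') = s \<otimes> (s' \<otimes> x)"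
      using that assms by (simp add: m_lcomm[of s y r'])
    also have "\<dots> \<longleftrightarrow> y \<otimes> r' = s' \<otimes> x"
      using that assms nz m_lcancel by auto
    finally show ?thesis .
  qed
  then have "(x, y) \<in> loc_frac R p r s \<longleftrightarrow> (x, y) \<in> loc_frac R p r' s'" for x y
    unfolding mem_loc_frac_iff[OF p assms(2,3)] mem_loc_frac_iff[OF p assms(4,5)] by auto
  then show ?thesis by auto
qed

text \<open>Sections are added and multiplied pointwise, so it suffices to check 1/1 + 1/1 = 2/1 and
  (2/1)(1/2) = 1/1 in each localisation. The constant fraction 1/2 is a section because 2 is
  nonzero, hence a unit, and lies in no prime ideal.\<close>

lemma Spec_two_inverse:
  assumes two: "\<one> \<oplus> \<one> \<noteq> \<zero>"
  defines "S \<equiv> sect (Spec R) (topspace (points (Spec R)))"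
  shows "\<one>\<^bsub>S\<^esub> \<in> carrier S" "\<one>\<^bsub>S\<^esub> \<oplus>\<^bsub>S\<^esub> \<one>\<^bsub>S\<^esub> \<in> carrier S"
    "\<exists>u\<in>carrier S. (\<one>\<^bsub>S\<^esub> \<oplus>\<^bsub>S\<^esub> \<one>\<^bsub>S\<^esub>) \<otimes>\<^bsub>S\<^esub> u = \<one>\<^bsub>S\<^esub>"
proof -
  define V where "V = topspace (zariski_topology R)"
  have V: "openin (zariski_topology R) V" by (simp add: V_def)
  have R: "cring R" by (rule is_cring)
  have pr: "primeideal p R" if "p \<in> V" for p
    using mem_topspace_zariski[OF R] that by (simp add: V_def)
  have nz: "b \<notin> p" if "p \<in> V" "b \<in> carrier R" "b \<noteq> \<zero>" for p b
  proof
    interpret p: primeideal p R using pr that(1) .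
    assume "b \<in> p"
    then have "inv b \<otimes> b \<in> p" using that by (intro p.I_l_closed) (simp_all add: field_Units)
    then show False using that p.one_imp_carrier p.I_notcarr by (simp add: field_Units)
  qed
  have S: "carrier S = Spec_sections R V" "\<one>\<^bsub>S\<^esub> = (\<lambda>p\<in>V. loc_frac R p \<one> \<one>)"
    "s \<oplus>\<^bsub>S\<^esub> t = (\<lambda>p\<in>V. s p \<oplus>\<^bsub>localisation R p\<^esub> t p)"
    "s \<otimes>\<^bsub>S\<^esub> t = (\<lambda>p\<in>V. s p \<otimes>\<^bsub>localisation R p\<^esub> t p)" for s t
    by (simp_all add: S_def Spec_def V_def localisation_def)
  have two_closed: "\<one> \<oplus> \<one> \<in> carrier R" by simp
  define l where "l p = loc_frac R p" for p
  have add: "l p \<one> \<one> \<oplus>\<^bsub>localisation R p\<^esub> l p \<one> \<one> = l p (\<one> \<oplus> \<one>) \<one>" if "p \<in> V" for p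
  proof -
    interpret p: primeideal p R using pr that .
    have o: "\<one> \<in> carrier R - p" using nz[OF that] by simp
    \<comment> \<open>The representatives of 1/1 are the pairs (s, s), so each sum is (s's +
      ss')/(ss'), which equals 2/1.\<close>
    have 1: "(r, s) \<in> l p \<one> \<one> \<longleftrightarrow> r \<in> carrier R \<and> s \<in> carrier R - p \<and> s \<otimes> \<one> = \<one> \<otimes> r" for r s
      unfolding l_def using mem_loc_frac_iff[OF p.primeideal_axioms _ o] by simp
    then have ne: "l p \<one> \<one> \<noteq> {}" using o by auto
    show ?thesis
      unfolding localisation_def ring.simps
    proof (simp, rule UN_pairs_constant[OF ne ne])
      fix r s r' s' assume "(r, s) \<in> l p \<one> \<one>" "(r', s') \<in> l p \<one> \<one>"
      then have c: "s \<in> carrier R - p" "s' \<in> carrier R - p" "r = s" "r' = s'"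
        by (auto simp: 1)
      then have "s \<otimes> s' \<in> carrier R - p" using p.I_prime[of s s'] by blast
      then show "loc_frac R p (s' \<otimes> r \<oplus> s \<otimes> r') (s \<otimes> s') = l p (\<one> \<oplus> \<one>) \<one>"
        unfolding l_def using c o
        by (intro loc_frac_cong pr that) (simp_all add: r_distr m_comm)
    qed
  qed
  have mult: "l p (\<one> \<oplus> \<one>) \<one> \<otimes>\<^bsub>localisation R p\<^esub> l p \<one> (\<one> \<oplus> \<one>) = l p \<one> \<one>" if "p \<in> V" for p
  proof -
    interpret p: primeideal p R using pr that .
    have o: "\<one> \<in> carrier R - p" "\<one> \<oplus> \<one> \<in> carrier R - p" using nz[OF that] two by simp_all
    \<comment> \<open>The representatives of 2/1 are (2s, s) and those of 1/2 are (r', 2r'), so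
      numerator and denominator of each product coincide.\<close>
    have 1: "(r, s) \<in> l p (\<one> \<oplus> \<one>) \<one> \<longleftrightarrow>
        r \<in> carrier R \<and> s \<in> carrier R - p \<and> s \<otimes> (\<one> \<oplus> \<one>) = \<one> \<otimes> r" for r s
      unfolding l_def using mem_loc_frac_iff[OF p.primeideal_axioms two_closed o(1)] by simp
    have 2: "(r, s) \<in> l p \<one> (\<one> \<oplus> \<one>) \<longleftrightarrow>
        r \<in> carrier R \<and> s \<in> carrier R - p \<and> s \<otimes> \<one> = (\<one> \<oplus> \<one>) \<otimes> r" for r s
      unfolding l_def using mem_loc_frac_iff[OF p.primeideal_axioms one_closed o(2)] by simp
    have ne: "l p (\<one> \<oplus> \<one>) \<one> \<noteq> {}" "l p \<one> (\<one> \<oplus> \<one>) \<noteq> {}"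
      using o 1[of "\<one> \<oplus> \<one>" \<one>] 2[of \<one> "\<one> \<oplus> \<one>"] by auto
    show ?thesis
      unfolding localisation_def ring.simps
    proof (simp, rule UN_pairs_constant[OF ne])
      fix r s r' s' assume "(r, s) \<in> l p (\<one> \<oplus> \<one>) \<one>" "(r', s') \<in> l p \<one> (\<one> \<oplus> \<one>)"
      then have c: "s \<in> carrier R - p" "s' \<in> carrier R - p" "r' \<in> carrier R"
        "r = s \<otimes> (\<one> \<oplus> \<one>)" "s' = (\<one> \<oplus> \<one>) \<otimes> r'"
        by (auto simp: 1 2)
      then have "s \<otimes> s' \<in> carrier R - p" using p.I_prime[of s s'] by blast
      moreover have "r \<otimes> r' = s \<otimes> s'" using c by (simp add: m_assoc)
      ultimately show "loc_frac R p (r \<otimes> r') (s \<otimes> s') = l p \<one> \<one>"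
        unfolding l_def using c o
        by (intro loc_frac_cong pr that) simp_all
    qed
  qed
  have sum: "\<one>\<^bsub>S\<^esub> \<oplus>\<^bsub>S\<^esub> \<one>\<^bsub>S\<^esub> = (\<lambda>p\<in>V. loc_frac R p (\<one> \<oplus> \<one>) \<one>)"
    unfolding S using add by (auto simp: l_def intro!: restrict_ext)
  show "\<one>\<^bsub>S\<^esub> \<in> carrier S" "\<one>\<^bsub>S\<^esub> \<oplus>\<^bsub>S\<^esub> \<one>\<^bsub>S\<^esub> \<in> carrier S"
    unfolding sum unfolding S using nz by (auto intro!: constant_fraction_section R V)
  have "(\<lambda>p\<in>V. loc_frac R p \<one> (\<one> \<oplus> \<one>)) \<in> carrier S"
    unfolding S using nz two by (auto intro!: constant_fraction_section R V)
  moreover have "(\<one>\<^bsub>S\<^esub> \<oplus>\<^bsub>S\<^esub> \<one>\<^bsub>S\<^esub>) \<otimes>\<^bsub>S\<^esub> (\<lambda>p\<in>V. loc_frac R p \<one> (\<one> \<oplus> \<one>)) = \<one>\<^bsub>S\<^esub>"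
    unfolding sum unfolding S using mult by (auto simp: l_def intro!: restrict_ext)
  ultimately show "\<exists>u\<in>carrier S. (\<one>\<^bsub>S\<^esub> \<oplus>\<^bsub>S\<^esub> \<one>\<^bsub>S\<^esub>) \<otimes>\<^bsub>S\<^esub> u = \<one>\<^bsub>S\<^esub>" by blast
qed

end

text \<open>The comorphism on global sections lands in the sections over the preimage
  \<open>W\<close> of the whole spectrum, which contains every open \<open>U\<close>; composing with
  restriction to \<open>U\<close> transports the inverse of 1 + 1.\<close>

lemma two_Units_sect:
  assumes K: "field K" "\<one>\<^bsub>K\<^esub> \<oplus>\<^bsub>K\<^esub> \<one>\<^bsub>K\<^esub> \<noteq> \<zero>\<^bsub>K\<^esub>"
    and Z: "scheme_over_field K Z f fs" and U: "openin (points Z) U"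
  shows "\<one>\<^bsub>sect Z U\<^esub> \<oplus>\<^bsub>sect Z U\<^esub> \<one>\<^bsub>sect Z U\<^esub> \<in> Units (sect Z U)"
proof -
  have mor: "ringed_space_morphism Z (Spec K) f fs" and rs: "ringed_space Z"
    using Z by (auto simp: scheme_over_field_def locally_ringed_space_morphism_def
        scheme_def locally_ringed_space_def)
  define V W where "V = topspace (points (Spec K))" and "W = preim Z f V"
  have V: "openin (points (Spec K)) V" by (simp add: V_def)
  have cont: "continuous_map (points Z) (points (Spec K)) f"
    using mor by (simp add: ringed_space_morphism_def)
  have W: "openin (points Z) W" "U \<subseteq> W"
    using openin_continuous_map_preimage[OF cont V] continuous_map_image_subset_topspace[OF cont]
      openin_subset[OF U] by (auto simp: W_def preim_def V_def)
  have fs: "fs V \<in> ring_hom (sect (Spec K) V) (sect Z W)"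
    using mor V by (simp add: ringed_space_morphism_def W_def)
  have rest: "rest Z W U \<in> ring_hom (sect Z W) (sect Z U)"
    using rs W U by (simp add: ringed_space_def)
  have cr: "cring (sect Z U)" using rs U by (simp add: ringed_space_def)
  obtain u where u: "u \<in> carrier (sect (Spec K) V)"
    "(\<one>\<^bsub>sect (Spec K) V\<^esub> \<oplus>\<^bsub>sect (Spec K) V\<^esub> \<one>\<^bsub>sect (Spec K) V\<^esub>) \<otimes>\<^bsub>sect (Spec K) V\<^esub> u
      = \<one>\<^bsub>sect (Spec K) V\<^esub>"
    using field.Spec_two_inverse(3)[OF K] unfolding V_def by blast
  have "rest Z W U \<circ> fs V \<in> ring_hom (sect (Spec K) V) (sect Z U)"
    using ring_hom_trans[OF fs rest] .
  from two_Units_ring_hom[OF this cr _ _ u] show ?thesis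
    using field.Spec_two_inverse(1,2)[OF K] unfolding V_def by blast
qed

section \<open>Algebras with a quadratic trace over a ring\<close>

locale noncomm_algebra = module R M + A?: ring M for R (structure) and M (structure) +
  assumes smult_mult_left: "\<lbrakk>r \<in> carrier R; a \<in> carrier M; b \<in> carrier M\<rbrakk>
      \<Longrightarrow> (r \<odot>\<^bsub>M\<^esub> a) \<otimes>\<^bsub>M\<^esub> b = r \<odot>\<^bsub>M\<^esub> (a \<otimes>\<^bsub>M\<^esub> b)"
    and smult_mult_right: "\<lbrakk>r \<in> carrier R; a \<in> carrier M; b \<in> carrier M\<rbrakk>
      \<Longrightarrow> a \<otimes>\<^bsub>M\<^esub> (r \<odot>\<^bsub>M\<^esub> b) = r \<odot>\<^bsub>M\<^esub> (a \<otimes>\<^bsub>M\<^esub> b)"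
begin

text \<open>This is \<open>alg_unit\<close> over one fixed open set; \<open>scalar_section\<close>
  identifies the two.\<close>

definition scalar :: "'a \<Rightarrow> 'c" where
  "scalar f = f \<odot>\<^bsub>M\<^esub> \<one>\<^bsub>M\<^esub>"

lemma scalar_closed [simp]: "f \<in> carrier R \<Longrightarrow> scalar f \<in> carrier M"
  by (simp add: scalar_def)

lemma scalar_one [simp]: "scalar \<one> = \<one>\<^bsub>M\<^esub>"
  by (simp add: scalar_def)

lemma scalar_add:
  "\<lbrakk>f \<in> carrier R; g \<in> carrier R\<rbrakk> \<Longrightarrow> scalar (f \<oplus> g) = scalar f \<oplus>\<^bsub>M\<^esub> scalar g"
  by (simp add: scalar_def smult_l_distr)

lemma scalar_minus: "f \<in> carrier R \<Longrightarrow> scalar (\<ominus> f) = \<ominus>\<^bsub>M\<^esub> scalar f"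
  by (simp add: scalar_def smult_l_minus)

lemma scalar_mult_left:
  "\<lbrakk>f \<in> carrier R; a \<in> carrier M\<rbrakk> \<Longrightarrow> scalar f \<otimes>\<^bsub>M\<^esub> a = f \<odot>\<^bsub>M\<^esub> a"
  by (simp add: scalar_def smult_mult_left)

lemma scalar_mult_right:
  "\<lbrakk>f \<in> carrier R; a \<in> carrier M\<rbrakk> \<Longrightarrow> a \<otimes>\<^bsub>M\<^esub> scalar f = f \<odot>\<^bsub>M\<^esub> a"
  by (simp add: scalar_def smult_mult_right)

lemma smult_scalar:
  "\<lbrakk>f \<in> carrier R; g \<in> carrier R\<rbrakk> \<Longrightarrow> f \<odot>\<^bsub>M\<^esub> scalar g = scalar (f \<otimes> g)"
  by (simp add: scalar_def smult_assoc1)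

end

section \<open>The commutator argument for the symmetry of the trace pairing\<close>

locale degree_two_trace = noncomm_algebra +
  fixes tr :: "'c \<Rightarrow> 'a"
  assumes tr_closed [simp]: "a \<in> carrier M \<Longrightarrow> tr a \<in> carrier R"
    and tr_add: "\<lbrakk>a \<in> carrier M; b \<in> carrier M\<rbrakk> \<Longrightarrow> tr (a \<oplus>\<^bsub>M\<^esub> b) = tr a \<oplus> tr b"
    and tr_smult: "\<lbrakk>r \<in> carrier R; a \<in> carrier M\<rbrakk> \<Longrightarrow> tr (r \<odot>\<^bsub>M\<^esub> a) = r \<otimes> tr a"
    and tr_quadratic: "a \<in> carrier M
      \<Longrightarrow> \<exists>g\<in>carrier R. (a \<otimes>\<^bsub>M\<^esub> a) \<ominus>\<^bsub>M\<^esub> (tr a \<odot>\<^bsub>M\<^esub> a) \<oplus>\<^bsub>M\<^esub> scalar g = \<zero>\<^bsub>M\<^esub>"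
begin

lemma square_eq:
  assumes "a \<in> carrier M"
  obtains g where "g \<in> carrier R" "a \<otimes>\<^bsub>M\<^esub> a = tr a \<odot>\<^bsub>M\<^esub> a \<oplus>\<^bsub>M\<^esub> scalar g"
proof -
  obtain g where g: "g \<in> carrier R" "(a \<otimes>\<^bsub>M\<^esub> a) \<ominus>\<^bsub>M\<^esub> (tr a \<odot>\<^bsub>M\<^esub> a) \<oplus>\<^bsub>M\<^esub> scalar g = \<zero>\<^bsub>M\<^esub>"
    using tr_quadratic assms by blast
  \<comment> \<open>The method \<open>algebra\<close> works in the ring \<open>M\<close> alone, so
    scalar multiples are named and enter as opaque ring elements. The same device is used
    below.\<close>
  define t s where "t = tr a \<odot>\<^bsub>M\<^esub> a" and "s = scalar g"
  have c: "t \<in> carrier M" "s \<in> carrier M" using assms g(1) by (simp_all add: t_def s_def)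
  have "a \<otimes>\<^bsub>M\<^esub> a = ((a \<otimes>\<^bsub>M\<^esub> a) \<ominus>\<^bsub>M\<^esub> t \<oplus>\<^bsub>M\<^esub> s) \<oplus>\<^bsub>M\<^esub> (t \<ominus>\<^bsub>M\<^esub> s)"
    using assms c by algebra
  also have "\<dots> = t \<oplus>\<^bsub>M\<^esub> scalar (\<ominus> g)"
    using g c by (simp add: t_def s_def scalar_minus M.minus_eq)
  finally show ?thesis using that[of "\<ominus> g"] g(1) by (simp add: t_def)
qed

text \<open>Subtract the relations for \<open>a\<close> and for \<open>b\<close> from the one for
  their sum; the three constant terms combine to s - p - q.\<close>

lemma polarised:
  assumes "a \<in> carrier M" "b \<in> carrier M"
  obtains h where "h \<in> carrier R"
    "a \<otimes>\<^bsub>M\<^esub> b \<oplus>\<^bsub>M\<^esub> b \<otimes>\<^bsub>M\<^esub> a = (tr a \<odot>\<^bsub>M\<^esub> b \<oplus>\<^bsub>M\<^esub> tr b \<odot>\<^bsub>M\<^esub> a) \<oplus>\<^bsub>M\<^esub> scalar h"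
proof -
  obtain p where p: "p \<in> carrier R" "a \<otimes>\<^bsub>M\<^esub> a = tr a \<odot>\<^bsub>M\<^esub> a \<oplus>\<^bsub>M\<^esub> scalar p"
    using square_eq assms(1) by blast
  obtain q where q: "q \<in> carrier R" "b \<otimes>\<^bsub>M\<^esub> b = tr b \<odot>\<^bsub>M\<^esub> b \<oplus>\<^bsub>M\<^esub> scalar q"
    using square_eq assms(2) by blast
  obtain s where s: "s \<in> carrier R" "(a \<oplus>\<^bsub>M\<^esub> b) \<otimes>\<^bsub>M\<^esub> (a \<oplus>\<^bsub>M\<^esub> b)
      = tr (a \<oplus>\<^bsub>M\<^esub> b) \<odot>\<^bsub>M\<^esub> (a \<oplus>\<^bsub>M\<^esub> b) \<oplus>\<^bsub>M\<^esub> scalar s"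
    using square_eq[of "a \<oplus>\<^bsub>M\<^esub> b"] assms by blast
  define ta tb where "ta = tr a \<odot>\<^bsub>M\<^esub> b" and "tb = tr b \<odot>\<^bsub>M\<^esub> a"
  define ua ub where "ua = tr a \<odot>\<^bsub>M\<^esub> a" and "ub = tr b \<odot>\<^bsub>M\<^esub> b"
  define P Q T where "P = scalar p" and "Q = scalar q" and "T = scalar s"
  note d = ta_def tb_def ua_def ub_def P_def Q_def T_def
  have c: "ta \<in> carrier M" "tb \<in> carrier M" "ua \<in> carrier M" "ub \<in> carrier M"
    "P \<in> carrier M" "Q \<in> carrier M" "T \<in> carrier M"
    using assms p(1) q(1) s(1) by (simp_all add: d)
  have e: "(a \<oplus>\<^bsub>M\<^esub> b) \<otimes>\<^bsub>M\<^esub> (a \<oplus>\<^bsub>M\<^esub> b) = ((ua \<oplus>\<^bsub>M\<^esub> ta) \<oplus>\<^bsub>M\<^esub> (tb \<oplus>\<^bsub>M\<^esub> ub)) \<oplus>\<^bsub>M\<^esub> T"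
    using assms s
    by (simp add: d tr_add smult_l_distr smult_r_distr M.a_ac)
  have "a \<otimes>\<^bsub>M\<^esub> b \<oplus>\<^bsub>M\<^esub> b \<otimes>\<^bsub>M\<^esub> a
      = ((a \<oplus>\<^bsub>M\<^esub> b) \<otimes>\<^bsub>M\<^esub> (a \<oplus>\<^bsub>M\<^esub> b) \<ominus>\<^bsub>M\<^esub> a \<otimes>\<^bsub>M\<^esub> a) \<ominus>\<^bsub>M\<^esub> b \<otimes>\<^bsub>M\<^esub> b"
    using assms by algebra
  also have "\<dots> = ((((ua \<oplus>\<^bsub>M\<^esub> ta) \<oplus>\<^bsub>M\<^esub> (tb \<oplus>\<^bsub>M\<^esub> ub)) \<oplus>\<^bsub>M\<^esub> T) \<ominus>\<^bsub>M\<^esub> (ua \<oplus>\<^bsub>M\<^esub> P)) \<ominus>\<^bsub>M\<^esub> (ub \<oplus>\<^bsub>M\<^esub> Q)"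
    unfolding e p(2) q(2) by (simp add: d)
  also have "\<dots> = (ta \<oplus>\<^bsub>M\<^esub> tb) \<oplus>\<^bsub>M\<^esub> ((T \<oplus>\<^bsub>M\<^esub> \<ominus>\<^bsub>M\<^esub> P) \<oplus>\<^bsub>M\<^esub> \<ominus>\<^bsub>M\<^esub> Q)"
    using c by algebra
  also have "(T \<oplus>\<^bsub>M\<^esub> \<ominus>\<^bsub>M\<^esub> P) \<oplus>\<^bsub>M\<^esub> \<ominus>\<^bsub>M\<^esub> Q = scalar (s \<oplus> \<ominus> p \<oplus> \<ominus> q)"
    using p(1) q(1) s(1) by (simp add: d scalar_add scalar_minus)
  finally show ?thesis
    using that[of "s \<oplus> \<ominus> p \<oplus> \<ominus> q"] p(1) q(1) s(1) by (simp add: ta_def tb_def)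
qed

lemma trace_commutator_smult:
  assumes "a \<in> carrier M" "b \<in> carrier M"
  obtains h where "h \<in> carrier R"
    "tr (a \<otimes>\<^bsub>M\<^esub> b \<ominus>\<^bsub>M\<^esub> b \<otimes>\<^bsub>M\<^esub> a) \<odot>\<^bsub>M\<^esub> a = scalar h"
proof -
  define D where "D = a \<otimes>\<^bsub>M\<^esub> b \<ominus>\<^bsub>M\<^esub> b \<otimes>\<^bsub>M\<^esub> a"
  have D: "D \<in> carrier M" using assms by (simp add: D_def)
  obtain p where p: "p \<in> carrier R" "a \<otimes>\<^bsub>M\<^esub> a = tr a \<odot>\<^bsub>M\<^esub> a \<oplus>\<^bsub>M\<^esub> scalar p"
    using square_eq assms(1) by blast
  obtain h where h: "h \<in> carrier R"
    "a \<otimes>\<^bsub>M\<^esub> D \<oplus>\<^bsub>M\<^esub> D \<otimes>\<^bsub>M\<^esub> a = (tr a \<odot>\<^bsub>M\<^esub> D \<oplus>\<^bsub>M\<^esub> tr D \<odot>\<^bsub>M\<^esub> a) \<oplus>\<^bsub>M\<^esub> scalar h"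
    using polarised[OF assms(1) D] by blast
  \<comment> \<open>Expanding D, the two terms aba cancel.\<close>
  have "a \<otimes>\<^bsub>M\<^esub> D \<oplus>\<^bsub>M\<^esub> D \<otimes>\<^bsub>M\<^esub> a = (a \<otimes>\<^bsub>M\<^esub> a) \<otimes>\<^bsub>M\<^esub> b \<ominus>\<^bsub>M\<^esub> b \<otimes>\<^bsub>M\<^esub> (a \<otimes>\<^bsub>M\<^esub> a)"
    unfolding D_def using assms by algebra
  \<comment> \<open>Substituting the relation for the square of \<open>a\<close>, the constant p
    contributes p b on both sides of the difference, because scalars are central.\<close>
  also have "\<dots> = (tr a \<odot>\<^bsub>M\<^esub> (a \<otimes>\<^bsub>M\<^esub> b) \<oplus>\<^bsub>M\<^esub> p \<odot>\<^bsub>M\<^esub> b) \<ominus>\<^bsub>M\<^esub> (tr a \<odot>\<^bsub>M\<^esub> (b \<otimes>\<^bsub>M\<^esub> a) \<oplus>\<^bsub>M\<^esub> p \<odot>\<^bsub>M\<^esub> b)"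
    unfolding p(2) using assms p(1)
    by (simp add: A.l_distr A.r_distr smult_mult_left smult_mult_right scalar_mult_left scalar_mult_right)
  also have "\<dots> = tr a \<odot>\<^bsub>M\<^esub> (a \<otimes>\<^bsub>M\<^esub> b) \<ominus>\<^bsub>M\<^esub> tr a \<odot>\<^bsub>M\<^esub> (b \<otimes>\<^bsub>M\<^esub> a)"
  proof -
    have "(x \<oplus>\<^bsub>M\<^esub> z) \<ominus>\<^bsub>M\<^esub> (y \<oplus>\<^bsub>M\<^esub> z) = x \<ominus>\<^bsub>M\<^esub> y"
      if "x \<in> carrier M" "y \<in> carrier M" "z \<in> carrier M" for x y z
      using that by algebra
    then show ?thesis using assms p(1) by simp
  qed
  also have "\<dots> = tr a \<odot>\<^bsub>M\<^esub> D"
    using assms by (simp add: D_def M.minus_eq smult_r_distr smult_r_minus)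
  finally have e: "tr a \<odot>\<^bsub>M\<^esub> D = (tr a \<odot>\<^bsub>M\<^esub> D \<oplus>\<^bsub>M\<^esub> tr D \<odot>\<^bsub>M\<^esub> a) \<oplus>\<^bsub>M\<^esub> scalar h"
    using h(2) by simp
  \<comment> \<open>Applied with x = tr(a) D, y = tr(D) a and z = \<open>scalar h\<close>: the
    common summand x cancels.\<close>
  have "y = \<ominus>\<^bsub>M\<^esub> z" if "x \<in> carrier M" "y \<in> carrier M" "z \<in> carrier M" "x = (x \<oplus>\<^bsub>M\<^esub> y) \<oplus>\<^bsub>M\<^esub> z" for x y z
  proof -
    have "y = ((x \<oplus>\<^bsub>M\<^esub> y) \<oplus>\<^bsub>M\<^esub> z) \<oplus>\<^bsub>M\<^esub> (\<ominus>\<^bsub>M\<^esub> x \<ominus>\<^bsub>M\<^esub> z)" using that(1-3) by algebra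
    also have "\<dots> = x \<oplus>\<^bsub>M\<^esub> (\<ominus>\<^bsub>M\<^esub> x \<ominus>\<^bsub>M\<^esub> z)" by (simp only: that(4)[symmetric])
    also have "\<dots> = \<ominus>\<^bsub>M\<^esub> z" using that(1-3) by algebra
    finally show ?thesis .
  qed
  from this[OF _ _ _ e] have "tr D \<odot>\<^bsub>M\<^esub> a = scalar (\<ominus> h)"
    using assms D h(1) by (simp add: scalar_minus)
  then show ?thesis using that[of "\<ominus> h"] h(1) by (simp add: D_def)
qed

lemma tr_minus: "a \<in> carrier M \<Longrightarrow> tr (\<ominus>\<^bsub>M\<^esub> a) = \<ominus> tr a"
  using tr_smult[of "\<ominus> \<one>" a] by (simp add: smult_l_minus R.l_minus)

lemma tr_zero: "tr \<zero>\<^bsub>M\<^esub> = \<zero>"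
  using tr_smult[of \<zero> "\<zero>\<^bsub>M\<^esub>"] by simp

lemma trace_commutator_square:
  assumes "a \<in> carrier M" "b \<in> carrier M"
  defines "D \<equiv> a \<otimes>\<^bsub>M\<^esub> b \<ominus>\<^bsub>M\<^esub> b \<otimes>\<^bsub>M\<^esub> a"
  shows "tr D \<otimes> tr D = \<zero>"
proof -
  have D: "D \<in> carrier M" using assms by (simp add: D_def)
  obtain h where h: "h \<in> carrier R" "tr D \<odot>\<^bsub>M\<^esub> a = scalar h"
    using trace_commutator_smult[OF assms(1,2)] by (auto simp: D_def)
  have "tr D \<odot>\<^bsub>M\<^esub> D = (tr D \<odot>\<^bsub>M\<^esub> a) \<otimes>\<^bsub>M\<^esub> b \<ominus>\<^bsub>M\<^esub> b \<otimes>\<^bsub>M\<^esub> (tr D \<odot>\<^bsub>M\<^esub> a)"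
    using assms(1,2) D
    by (simp add: smult_mult_left smult_mult_right)
      (simp add: D_def M.minus_eq smult_r_distr smult_r_minus)
  also have "\<dots> = \<zero>\<^bsub>M\<^esub>"
    using h assms(2) by (simp add: scalar_mult_left scalar_mult_right M.r_neg M.minus_eq)
  finally show ?thesis using tr_smult[of "tr D" D] D tr_zero by simp
qed

text \<open>The alternative of the zero ring is there for the empty open set. In a domain the
  vanishing square from \<open>trace_commutator_square\<close> forces the trace of the commutator to
  vanish.\<close>

lemma trace_mult_commute:
  assumes "a \<in> carrier M" "b \<in> carrier M" and "domain R \<or> carrier R = {\<zero>}"
  shows "tr (a \<otimes>\<^bsub>M\<^esub> b) = tr (b \<otimes>\<^bsub>M\<^esub> a)"
proof -
  define D where "D = a \<otimes>\<^bsub>M\<^esub> b \<ominus>\<^bsub>M\<^esub> b \<otimes>\<^bsub>M\<^esub> a"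
  have "tr D \<in> carrier R" "tr D \<otimes> tr D = \<zero>"
    using assms(1,2) trace_commutator_square by (simp_all add: D_def)
  then have "tr D = \<zero>" using assms(3) domain.integral[of R "tr D" "tr D"] by auto
  then have "tr (a \<otimes>\<^bsub>M\<^esub> b) \<ominus> tr (b \<otimes>\<^bsub>M\<^esub> a) = \<zero>"
    using assms(1,2) by (simp add: D_def M.minus_eq tr_add tr_minus R.minus_eq)
  then show ?thesis using assms(1,2) by (simp add: R.r_right_minus_eq)
qed

end

section \<open>Division by two and normalised traces\<close>

lemma (in cring) half_closed: "\<one> \<oplus> \<one> \<in> Units R \<Longrightarrow> half R \<in> carrier R"
  by (simp add: half_def)

lemma (in cring) half_double:
  assumes "\<one> \<oplus> \<one> \<in> Units R" "f \<in> carrier R"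
  shows "half R \<otimes> (f \<oplus> f) = f"
proof -
  have "half R \<otimes> (f \<oplus> f) = half R \<otimes> ((\<one> \<oplus> \<one>) \<otimes> f)"
    using assms by (simp add: l_distr)
  also have "\<dots> = f"
    using assms by (simp add: half_def m_assoc[symmetric])
  finally show ?thesis .
qed

lemma (in cring) double_eq_half:
  assumes "\<one> \<oplus> \<one> \<in> Units R" "t \<in> carrier R"
  shows "half R \<otimes> t \<oplus> half R \<otimes> t = t"
proof -
  have "half R \<otimes> t \<oplus> half R \<otimes> t = half R \<otimes> (t \<oplus> t)"
    using assms half_closed by (simp add: r_distr)
  then show ?thesis using half_double assms by simp
qed

text \<open>Adds to the quadratic relation the condition that half the trace retracts
  \<open>scalar\<close>, together with the invertibility that makes \<open>half\<close> an actual
  inverse of two.\<close>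

locale normalised_trace = degree_two_trace +
  assumes two: "\<one> \<oplus> \<one> \<in> Units R"
    and half_tr_scalar: "f \<in> carrier R \<Longrightarrow> half R \<otimes> tr (scalar f) = f"
begin

lemma tr_scalar: "f \<in> carrier R \<Longrightarrow> tr (scalar f) = f \<oplus> f"
  using R.double_eq_half[OF two, of "tr (scalar f)"] half_tr_scalar by simp

lemma kernel_submodule: "submodule {a \<in> carrier M. tr a = \<zero>} R M"
  by (rule submoduleI) (auto simp: tr_zero tr_minus tr_add tr_smult)

text \<open>The linear term of the quadratic relation carries the factor tr x, so only the constant
  term survives.\<close>

lemma kernel_square:
  assumes "x \<in> carrier M" "tr x = \<zero>"
  shows "\<exists>g\<in>carrier R. x \<otimes>\<^bsub>M\<^esub> x = scalar g"
  using square_eq[OF assms(1)] assms by (metis smult_l_null M.l_zero scalar_closed)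

lemma kernel_splits:
  "bij_betw (\<lambda>(f, x). scalar f \<oplus>\<^bsub>M\<^esub> x) (carrier R \<times> {a \<in> carrier M. tr a = \<zero>}) (carrier M)"
proof (rule bij_betw_byWitness[where f' = "\<lambda>a. (half R \<otimes> tr a, a \<ominus>\<^bsub>M\<^esub> scalar (half R \<otimes> tr a))"])
  have hc: "half R \<otimes> tr a \<in> carrier R" if "a \<in> carrier M" for a
    using that two R.half_closed by simp
  have canc: "(s \<oplus>\<^bsub>M\<^esub> x) \<ominus>\<^bsub>M\<^esub> s = x" "s \<oplus>\<^bsub>M\<^esub> (x \<ominus>\<^bsub>M\<^esub> s) = x"
    if "s \<in> carrier M" "x \<in> carrier M" for s x
    using that by algebra+
  have part: "half R \<otimes> tr (scalar f \<oplus>\<^bsub>M\<^esub> x) = f"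
    if "f \<in> carrier R" "x \<in> carrier M" "tr x = \<zero>" for f x
    using that two by (simp add: tr_add tr_scalar R.half_double)
  \<comment> \<open>By \<open>tr_scalar\<close> the scalar being subtracted has trace twice half of
    tr a, that is, tr a itself.\<close>
  have ker: "tr (a \<ominus>\<^bsub>M\<^esub> scalar (half R \<otimes> tr a)) = \<zero>" if "a \<in> carrier M" for a
    using that hc[OF that] two
    by (simp add: M.minus_eq tr_add tr_minus tr_scalar R.double_eq_half R.r_neg)
  show "\<forall>z\<in>carrier R \<times> {a \<in> carrier M. tr a = \<zero>}.
      (\<lambda>a. (half R \<otimes> tr a, a \<ominus>\<^bsub>M\<^esub> scalar (half R \<otimes> tr a))) ((\<lambda>(f, x). scalar f \<oplus>\<^bsub>M\<^esub> x) z) = z"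
    using part canc(1) by auto
  show "\<forall>a\<in>carrier M. (\<lambda>(f, x). scalar f \<oplus>\<^bsub>M\<^esub> x)
      (half R \<otimes> tr a, a \<ominus>\<^bsub>M\<^esub> scalar (half R \<otimes> tr a)) = a"
    using hc canc(2) by simp
  show "(\<lambda>(f, x). scalar f \<oplus>\<^bsub>M\<^esub> x) ` (carrier R \<times> {a \<in> carrier M. tr a = \<zero>}) \<subseteq> carrier M"
    by auto
  show "(\<lambda>a. (half R \<otimes> tr a, a \<ominus>\<^bsub>M\<^esub> scalar (half R \<otimes> tr a))) ` carrier M
      \<subseteq> carrier R \<times> {a \<in> carrier M. tr a = \<zero>}"
    using hc ker by auto
qed

lemma tr_one: "tr \<one>\<^bsub>M\<^esub> = \<one> \<oplus> \<one>"
  using tr_scalar[of \<one>] by simp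

text \<open>The trace of the quadratic relation reads tr(a^2) - tr(a)^2 + 2g = 0, which determines
  the constant g once two is invertible.\<close>

lemma cayley_hamilton:
  assumes a: "a \<in> carrier M"
  shows "(a \<otimes>\<^bsub>M\<^esub> a) \<ominus>\<^bsub>M\<^esub> (tr a \<odot>\<^bsub>M\<^esub> a)
    \<oplus>\<^bsub>M\<^esub> scalar (half R \<otimes> ((tr a \<otimes> tr a) \<ominus> tr (a \<otimes>\<^bsub>M\<^esub> a))) = \<zero>\<^bsub>M\<^esub>"
proof -
  obtain g where g: "g \<in> carrier R"
    "(a \<otimes>\<^bsub>M\<^esub> a) \<ominus>\<^bsub>M\<^esub> (tr a \<odot>\<^bsub>M\<^esub> a) \<oplus>\<^bsub>M\<^esub> scalar g = \<zero>\<^bsub>M\<^esub>"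
    using tr_quadratic a by blast
  define t s where "t = tr (a \<otimes>\<^bsub>M\<^esub> a)" and "s = tr a \<otimes> tr a"
  have c: "t \<in> carrier R" "s \<in> carrier R" using a by (simp_all add: t_def s_def)
  have "\<zero> = tr ((a \<otimes>\<^bsub>M\<^esub> a) \<ominus>\<^bsub>M\<^esub> (tr a \<odot>\<^bsub>M\<^esub> a) \<oplus>\<^bsub>M\<^esub> scalar g)"
    by (simp add: g(2) tr_zero)
  also have "\<dots> = (t \<ominus> s) \<oplus> (g \<oplus> g)"
    using a g(1) by (simp add: M.minus_eq R.minus_eq tr_add tr_minus tr_smult tr_scalar t_def s_def)
  finally have e: "(t \<ominus> s) \<oplus> (g \<oplus> g) = \<zero>" by simp
  have "g \<oplus> g = ((t \<ominus> s) \<oplus> (g \<oplus> g)) \<oplus> (s \<ominus> t)" using c g(1) by algebra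
  also have "\<dots> = s \<ominus> t" using c by (simp add: e)
  finally have "half R \<otimes> (s \<ominus> t) = g"
    using R.half_double[OF two g(1)] by simp
  then show ?thesis using g(2) by (simp add: t_def s_def)
qed

end

section \<open>The projection to scalars given by a splitting, and the quadratic relation for its
  double\<close>

locale split_algebra = noncomm_algebra +
  fixes S
  assumes S_submodule: "submodule S R M"
    and S_splits: "bij_betw (\<lambda>(f, x). scalar f \<oplus>\<^bsub>M\<^esub> x) (carrier R \<times> S) (carrier M)"
begin

text \<open>The description is proper on \<open>carrier M\<close>: existence is surjectivity of the
  splitting map (\<open>decompose\<close>), and uniqueness is its injectivity
  (\<open>scalar_part_eq\<close>).\<close>

definition scalar_part :: "'c \<Rightarrow> 'a" where
  "scalar_part a = (THE f. f \<in> carrier R \<and> (\<exists>x\<in>S. a = scalar f \<oplus>\<^bsub>M\<^esub> x))"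

lemma S_carrier [simp]: "x \<in> S \<Longrightarrow> x \<in> carrier M"
  using submoduleE(1)[OF S_submodule] by blast

lemma decompose:
  assumes "a \<in> carrier M"
  obtains f x where "f \<in> carrier R" "x \<in> S" "a = scalar f \<oplus>\<^bsub>M\<^esub> x"
proof -
  have "a \<in> (\<lambda>(f, x). scalar f \<oplus>\<^bsub>M\<^esub> x) ` (carrier R \<times> S)"
    using S_splits assms by (simp add: bij_betw_imp_surj_on)
  then show ?thesis using that by auto
qed

lemma scalar_part_eq:
  assumes "f \<in> carrier R" "x \<in> S"
  shows "scalar_part (scalar f \<oplus>\<^bsub>M\<^esub> x) = f"
  unfolding scalar_part_def
proof (rule the_equality)
  show "f \<in> carrier R \<and> (\<exists>y\<in>S. scalar f \<oplus>\<^bsub>M\<^esub> x = scalar f \<oplus>\<^bsub>M\<^esub> y)" using assms by blast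
next
  fix f' assume "f' \<in> carrier R \<and> (\<exists>y\<in>S. scalar f \<oplus>\<^bsub>M\<^esub> x = scalar f' \<oplus>\<^bsub>M\<^esub> y)"
  then obtain y where y: "f' \<in> carrier R" "y \<in> S" "scalar f \<oplus>\<^bsub>M\<^esub> x = scalar f' \<oplus>\<^bsub>M\<^esub> y" by blast
  then have "(f, x) = (f', y)"
    using inj_onD[OF bij_betw_imp_inj_on[OF S_splits], of "(f, x)" "(f', y)"] assms by simp
  then show "f' = f" by simp
qed

lemma S_zero: "\<zero>\<^bsub>M\<^esub> \<in> S"
  using submoduleE(2,4)[OF S_submodule] S_carrier by (metis R.zero_closed all_not_in_conv smult_l_null)

lemma scalar_part_scalar: "f \<in> carrier R \<Longrightarrow> scalar_part (scalar f) = f"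
  using scalar_part_eq[of f, OF _ S_zero] by simp

lemma scalar_part_closed: "a \<in> carrier M \<Longrightarrow> scalar_part a \<in> carrier R"
  using decompose scalar_part_eq by metis

lemma scalar_part_add:
  assumes "a \<in> carrier M" "b \<in> carrier M"
  shows "scalar_part (a \<oplus>\<^bsub>M\<^esub> b) = scalar_part a \<oplus> scalar_part b"
proof -
  obtain f x where a: "f \<in> carrier R" "x \<in> S" "a = scalar f \<oplus>\<^bsub>M\<^esub> x"
    using decompose assms(1) by blast
  obtain g y where b: "g \<in> carrier R" "y \<in> S" "b = scalar g \<oplus>\<^bsub>M\<^esub> y"
    using decompose assms(2) by blast
  have "a \<oplus>\<^bsub>M\<^esub> b = scalar (f \<oplus> g) \<oplus>\<^bsub>M\<^esub> (x \<oplus>\<^bsub>M\<^esub> y)"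
    using a b by (simp add: scalar_add M.a_ac)
  then show ?thesis
    using a b submoduleE(5)[OF S_submodule] by (simp add: scalar_part_eq)
qed

lemma scalar_part_smult:
  assumes "r \<in> carrier R" "a \<in> carrier M"
  shows "scalar_part (r \<odot>\<^bsub>M\<^esub> a) = r \<otimes> scalar_part a"
proof -
  obtain f x where a: "f \<in> carrier R" "x \<in> S" "a = scalar f \<oplus>\<^bsub>M\<^esub> x"
    using decompose assms(2) by blast
  have "r \<odot>\<^bsub>M\<^esub> a = scalar (r \<otimes> f) \<oplus>\<^bsub>M\<^esub> (r \<odot>\<^bsub>M\<^esub> x)"
    using a assms by (simp add: smult_r_distr smult_scalar)
  then show ?thesis
    using a assms submoduleE(4)[OF S_submodule] by (simp add: scalar_part_eq)
qed

text \<open>Write a = s + x with s the scalar f. As s is central, a^2 - 2sa = x^2 - s^2, which is a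
  scalar; the constant term is thus the norm f^2 - x^2.\<close>

lemma quadratic_of_square:
  assumes sq: "\<And>x. x \<in> S \<Longrightarrow> \<exists>g\<in>carrier R. x \<otimes>\<^bsub>M\<^esub> x = scalar g"
    and "a \<in> carrier M"
  shows "\<exists>g\<in>carrier R. (a \<otimes>\<^bsub>M\<^esub> a) \<ominus>\<^bsub>M\<^esub> ((scalar_part a \<oplus> scalar_part a) \<odot>\<^bsub>M\<^esub> a)
      \<oplus>\<^bsub>M\<^esub> scalar g = \<zero>\<^bsub>M\<^esub>"
proof -
  obtain f x where a: "f \<in> carrier R" "x \<in> S" "a = scalar f \<oplus>\<^bsub>M\<^esub> x"
    using decompose assms(2) by blast
  obtain g where g: "g \<in> carrier R" "x \<otimes>\<^bsub>M\<^esub> x = scalar g" using sq a(2) by blast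
  define s where "s = scalar f"
  have c: "s \<in> carrier M" "x \<in> carrier M" using a by (simp_all add: s_def)
  have comm: "x \<otimes>\<^bsub>M\<^esub> s = s \<otimes>\<^bsub>M\<^esub> x"
    using a by (simp add: s_def scalar_mult_left scalar_mult_right)
  have "(scalar_part a \<oplus> scalar_part a) \<odot>\<^bsub>M\<^esub> a = (s \<oplus>\<^bsub>M\<^esub> s) \<otimes>\<^bsub>M\<^esub> (s \<oplus>\<^bsub>M\<^esub> x)"
    using a assms(2) by (simp add: scalar_part_eq s_def scalar_mult_left scalar_add[symmetric])
  moreover have "a \<otimes>\<^bsub>M\<^esub> a = (s \<otimes>\<^bsub>M\<^esub> s \<oplus>\<^bsub>M\<^esub> (s \<otimes>\<^bsub>M\<^esub> x \<oplus>\<^bsub>M\<^esub> x \<otimes>\<^bsub>M\<^esub> s)) \<oplus>\<^bsub>M\<^esub> x \<otimes>\<^bsub>M\<^esub> x"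
    unfolding a(3) s_def[symmetric] using c by algebra
  moreover have "scalar (f \<otimes> f \<ominus> g) = s \<otimes>\<^bsub>M\<^esub> s \<ominus>\<^bsub>M\<^esub> x \<otimes>\<^bsub>M\<^esub> x"
    using a g by (simp add: s_def R.minus_eq M.minus_eq scalar_add scalar_minus
        scalar_mult_left smult_scalar)
  moreover have "((s \<otimes>\<^bsub>M\<^esub> s \<oplus>\<^bsub>M\<^esub> (s \<otimes>\<^bsub>M\<^esub> x \<oplus>\<^bsub>M\<^esub> x \<otimes>\<^bsub>M\<^esub> s)) \<oplus>\<^bsub>M\<^esub> x \<otimes>\<^bsub>M\<^esub> x)
      \<ominus>\<^bsub>M\<^esub> ((s \<oplus>\<^bsub>M\<^esub> s) \<otimes>\<^bsub>M\<^esub> (s \<oplus>\<^bsub>M\<^esub> x)) \<oplus>\<^bsub>M\<^esub> (s \<otimes>\<^bsub>M\<^esub> s \<ominus>\<^bsub>M\<^esub> x \<otimes>\<^bsub>M\<^esub> x) = \<zero>\<^bsub>M\<^esub>"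
    unfolding comm using c by algebra
  ultimately show ?thesis
    using a g by (intro bexI[of _ "f \<otimes> f \<ominus> g"]) simp_all
qed

end

section \<open>Traces and splittings on sheaves\<close>

lemma presheaf_res_closed:
  "\<lbrakk>presheaf_of_sets T F r; openin T U; openin T V; V \<subseteq> U; s \<in> F U\<rbrakk> \<Longrightarrow> r U V s \<in> F V"
  by (simp add: presheaf_of_sets_def Pi_iff)

lemma presheaf_res_id:
  "\<lbrakk>presheaf_of_sets T F r; openin T U; s \<in> F U\<rbrakk> \<Longrightarrow> r U U s = s"
  by (simp add: presheaf_of_sets_def)

lemma presheaf_res_res:
  "\<lbrakk>presheaf_of_sets T F r; openin T U; openin T V; openin T W; W \<subseteq> V; V \<subseteq> U; s \<in> F U\<rbrakk>
    \<Longrightarrow> r V W (r U V s) = r U W s"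
  by (simp add: presheaf_of_sets_def)

lemma sheaf_glue:
  assumes "sheaf_of_sets T F r" "\<forall>V\<in>\<C>. openin T V \<and> s V \<in> F V"
    and "\<forall>V\<in>\<C>. \<forall>W\<in>\<C>. r V (V \<inter> W) (s V) = r W (V \<inter> W) (s W)"
  shows "\<exists>!t. t \<in> F (\<Union>\<C>) \<and> (\<forall>V\<in>\<C>. r (\<Union>\<C>) V t = s V)"
  using conjunct2[OF assms(1)[unfolded sheaf_of_sets_def], THEN spec, THEN spec, THEN mp, THEN mp,
      OF assms(2,3)] .

text \<open>The restrictions of \<open>t\<close> form a compatible family which both
  \<open>t\<close> and \<open>t'\<close> glue, so uniqueness of gluing applies. The cover may be
  empty, which is how sections over the empty set are compared.\<close>

lemma sheaf_section_eqI:
  assumes F: "sheaf_of_sets T F r" and C: "\<And>V. V \<in> \<C> \<Longrightarrow> openin T V"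
    and t: "t \<in> F (\<Union>\<C>)" "t' \<in> F (\<Union>\<C>)"
    and eq: "\<And>V. V \<in> \<C> \<Longrightarrow> r (\<Union>\<C>) V t = r (\<Union>\<C>) V t'"
  shows "t = t'"
proof -
  have U: "openin T (\<Union>\<C>)" using C by (rule openin_Union)
  have P: "presheaf_of_sets T F r" using F by (simp add: sheaf_of_sets_def)
  define s where "s V = r (\<Union>\<C>) V t" for V
  have "\<forall>V\<in>\<C>. openin T V \<and> s V \<in> F V"
    using presheaf_res_closed[OF P U _ _ t(1)] C by (simp add: s_def Union_upper)
  moreover have "r V (V \<inter> W) (s V) = r W (V \<inter> W) (s W)" if "V \<in> \<C>" "W \<in> \<C>" for V W
  proof -
    have comp: "r V' (V \<inter> W) (r (\<Union>\<C>) V' t) = r (\<Union>\<C>) (V \<inter> W) t" if "V' \<in> {V, W}" for V'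
    proof -
      have "V' \<in> \<C>" "V \<inter> W \<subseteq> V'" "V' \<subseteq> \<Union>\<C>" using that \<open>V \<in> \<C>\<close> \<open>W \<in> \<C>\<close> by (auto intro: Union_upper)
      moreover have "openin T (V \<inter> W)" using C \<open>V \<in> \<C>\<close> \<open>W \<in> \<C>\<close> by (simp add: openin_Int)
      ultimately show ?thesis using C by (intro presheaf_res_res[OF P U _ _ _ _ t(1)])
    qed
    show ?thesis by (simp add: s_def comp)
  qed
  ultimately have "\<exists>!t. t \<in> F (\<Union>\<C>) \<and> (\<forall>V\<in>\<C>. r (\<Union>\<C>) V t = s V)"
    by - (rule sheaf_glue[OF F], assumption, intro ballI)
  moreover have "\<forall>V\<in>\<C>. r (\<Union>\<C>) V t = s V" "\<forall>V\<in>\<C>. r (\<Union>\<C>) V t' = s V"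
    using eq by (simp_all add: s_def)
  ultimately show ?thesis using t by (metis (no_types, lifting))
qed

text \<open>Existence and uniqueness of gluings are inherited from \<open>F\<close>; only membership
  of the glued section in \<open>S\<close> has to be local, which is \<open>loc\<close>.\<close>

lemma subsheafI:
  assumes F: "sheaf_of_sets T F r"
    and sub: "\<And>U. openin T U \<Longrightarrow> S U \<subseteq> F U"
    and res: "\<And>U V s. openin T U \<Longrightarrow> openin T V \<Longrightarrow> V \<subseteq> U \<Longrightarrow> s \<in> S U \<Longrightarrow> r U V s \<in> S V"
    and loc: "\<And>\<C> t. (\<And>V. V \<in> \<C> \<Longrightarrow> openin T V) \<Longrightarrow> t \<in> F (\<Union>\<C>) \<Longrightarrow>
      (\<And>V. V \<in> \<C> \<Longrightarrow> r (\<Union>\<C>) V t \<in> S V) \<Longrightarrow> t \<in> S (\<Union>\<C>)"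
  shows "sheaf_of_sets T S r"
  unfolding sheaf_of_sets_def
proof (intro conjI allI impI)
  have P: "presheaf_of_sets T F r" using F by (simp add: sheaf_of_sets_def)
  show "presheaf_of_sets T S r"
    unfolding presheaf_of_sets_def
  proof (intro conjI allI impI ballI)
    show "r U V \<in> S U \<rightarrow> S V" if "openin T U" "openin T V" "V \<subseteq> U" for U V
      using res[OF that] by (rule Pi_I)
    show "r U U s = s" if "openin T U" "s \<in> S U" for U s
      by (rule presheaf_res_id[OF P that(1) subsetD[OF sub[OF that(1)] that(2)]])
    show "r V W (r U V s) = r U W s"
      if "openin T U" "openin T V" "openin T W" "W \<subseteq> V" "V \<subseteq> U" "s \<in> S U" for U V W s
      by (rule presheaf_res_res[OF P that(1-5) subsetD[OF sub[OF that(1)] that(6)]])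
  qed
  fix \<C> s
  assume C: "\<forall>V\<in>\<C>. openin T V \<and> s V \<in> S V"
    and compat: "\<forall>V\<in>\<C>. \<forall>W\<in>\<C>. r V (V \<inter> W) (s V) = r W (V \<inter> W) (s W)"
  have U: "openin T (\<Union>\<C>)" using C by (simp add: openin_Union)
  have "\<forall>V\<in>\<C>. openin T V \<and> s V \<in> F V" using C subsetD[OF sub] by simp
  from sheaf_glue[OF F this compat]
  have ex: "\<exists>!t. t \<in> F (\<Union>\<C>) \<and> (\<forall>V\<in>\<C>. r (\<Union>\<C>) V t = s V)" .
  then obtain t where t: "t \<in> F (\<Union>\<C>)" "\<forall>V\<in>\<C>. r (\<Union>\<C>) V t = s V" by blast
  then have "t \<in> S (\<Union>\<C>)" using C by (intro loc) simp_all
  then show "\<exists>!t. t \<in> S (\<Union>\<C>) \<and> (\<forall>V\<in>\<C>. r (\<Union>\<C>) V t = s V)"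
    using ex t subsetD[OF sub[OF U]] by (metis (no_types, lifting))
qed

section \<open>From single open sets to the sheaf\<close>

lemma noncomm_algebra_section:
  assumes "sheaf_of_algebras Z A" "openin (points Z) U"
  shows "noncomm_algebra (sect Z U) (msect A U)"
  using assms unfolding sheaf_of_algebras_def sheaf_of_modules_def
  by (intro noncomm_algebra.intro noncomm_algebra_axioms.intro) simp_all

lemma scalar_section:
  assumes "sheaf_of_algebras Z A" "openin (points Z) U"
  shows "noncomm_algebra.scalar (msect A U) = alg_unit A U"
  using noncomm_algebra.scalar_def[OF noncomm_algebra_section[OF assms]]
  by (simp add: fun_eq_iff alg_unit_def)

lemma normalised_trace_section:
  assumes A: "sheaf_of_algebras Z A" and tr: "quaternion_trace Z A tr" and U: "openin (points Z) U"
    and two: "\<one>\<^bsub>sect Z U\<^esub> \<oplus>\<^bsub>sect Z U\<^esub> \<one>\<^bsub>sect Z U\<^esub> \<in> Units (sect Z U)"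
  shows "normalised_trace (sect Z U) (msect A U) (tr U)"
proof -
  have h: "tr U \<in> carrier (msect A U) \<rightarrow> carrier (sect Z U)"
    "\<forall>a\<in>carrier (msect A U). \<forall>b\<in>carrier (msect A U).
      tr U (a \<oplus>\<^bsub>msect A U\<^esub> b) = tr U a \<oplus>\<^bsub>sect Z U\<^esub> tr U b"
    "\<forall>r\<in>carrier (sect Z U). \<forall>a\<in>carrier (msect A U).
      tr U (r \<odot>\<^bsub>msect A U\<^esub> a) = r \<otimes>\<^bsub>sect Z U\<^esub> tr U a"
    using tr U by (simp_all add: quaternion_trace_def module_sheaf_hom_def structure_module_def)
  show ?thesis
  proof (intro normalised_trace.intro degree_two_trace.intro degree_two_trace_axioms.intro
      normalised_trace_axioms.intro)
    show "noncomm_algebra (sect Z U) (msect A U)" using noncomm_algebra_section[OF A U] .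
    show "\<one>\<^bsub>sect Z U\<^esub> \<oplus>\<^bsub>sect Z U\<^esub> \<one>\<^bsub>sect Z U\<^esub> \<in> Units (sect Z U)" by (rule two)
  qed (use h tr U in \<open>auto simp: scalar_section[OF A U] quaternion_trace_def\<close>)
qed

lemma split_algebra_section:
  assumes A: "sheaf_of_algebras Z A" and S: "splits_off_structure_sheaf Z A S"
    and U: "openin (points Z) U"
  shows "split_algebra (sect Z U) (msect A U) (S U)"
  using noncomm_algebra_section[OF A U] S U
  by (intro split_algebra.intro split_algebra_axioms.intro)
    (auto simp: scalar_section[OF A U] splits_off_structure_sheaf_def submodule_sheaf_def)

text \<open>On each open set this is \<open>kernel_splits\<close>. The kernel is a sheaf because the
  trace commutes with restriction, so a section that is traceless on every member of a cover has a
  trace restricting to zero there.\<close>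

lemma trace_kernel_splits_off:
  assumes Z: "ringed_space Z" and A: "sheaf_of_algebras Z A" and tr: "quaternion_trace Z A tr"
    and two: "\<And>U. openin (points Z) U \<Longrightarrow>
      \<one>\<^bsub>sect Z U\<^esub> \<oplus>\<^bsub>sect Z U\<^esub> \<one>\<^bsub>sect Z U\<^esub> \<in> Units (sect Z U)"
  shows "splits_off_structure_sheaf Z A
    (\<lambda>U. {a \<in> carrier (msect A U). tr U a = \<zero>\<^bsub>sect Z U\<^esub>})"
proof -
  note nt = normalised_trace_section[OF A tr _ two]
  have MA: "sheaf_of_sets (points Z) (\<lambda>U. carrier (msect A U)) (mrest A)"
    using A by (simp add: sheaf_of_algebras_def sheaf_of_modules_def)
  have MZ: "sheaf_of_sets (points Z) (\<lambda>U. carrier (sect Z U)) (rest Z)"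
    using Z by (simp add: ringed_space_def)
  have res: "mrest A U V a \<in> carrier (msect A V)"
    if "openin (points Z) U" "openin (points Z) V" "V \<subseteq> U" "a \<in> carrier (msect A U)" for U V a
    using presheaf_res_closed[OF conjunct1[OF MA[unfolded sheaf_of_sets_def]] that] .
  have nat: "tr V (mrest A U V a) = rest Z U V (tr U a)"
    if "openin (points Z) U" "openin (points Z) V" "V \<subseteq> U" "a \<in> carrier (msect A U)" for U V a
    using tr that by (simp add: quaternion_trace_def module_sheaf_hom_def structure_module_def)
  have zero: "rest Z U V \<zero>\<^bsub>sect Z U\<^esub> = \<zero>\<^bsub>sect Z V\<^esub>"
    if "openin (points Z) U" "openin (points Z) V" "V \<subseteq> U" for U V
    using Z that unfolding ringed_space_def
    by (intro ring_hom_zero) (auto intro: cring.axioms)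
  have "sheaf_of_sets (points Z) (\<lambda>U. {a \<in> carrier (msect A U). tr U a = \<zero>\<^bsub>sect Z U\<^esub>}) (mrest A)"
  proof (rule subsheafI[OF MA])
    fix \<C> t
    assume C: "\<And>V. V \<in> \<C> \<Longrightarrow> openin (points Z) V" and t: "t \<in> carrier (msect A (\<Union>\<C>))"
      and l: "\<And>V. V \<in> \<C> \<Longrightarrow> mrest A (\<Union>\<C>) V t \<in> {a \<in> carrier (msect A V). tr V a = \<zero>\<^bsub>sect Z V\<^esub>}"
    have U: "openin (points Z) (\<Union>\<C>)" using C by blast
    interpret normalised_trace "sect Z (\<Union>\<C>)" "msect A (\<Union>\<C>)" "tr (\<Union>\<C>)" using nt[OF U U] .
    have "tr (\<Union>\<C>) t = \<zero>\<^bsub>sect Z (\<Union>\<C>)\<^esub>"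
    proof (rule sheaf_section_eqI[OF MZ C])
      fix V assume "V \<in> \<C>"
      moreover from this have "V \<subseteq> \<Union>\<C>" by blast
      ultimately show "rest Z (\<Union>\<C>) V (tr (\<Union>\<C>) t) = rest Z (\<Union>\<C>) V \<zero>\<^bsub>sect Z (\<Union>\<C>)\<^esub>"
        using l[of V] nat[OF U C _ t, of V] zero[OF U C, of V] by simp
    qed (use t in simp_all)
    then show "t \<in> {a \<in> carrier (msect A (\<Union>\<C>)). tr (\<Union>\<C>) a = \<zero>\<^bsub>sect Z (\<Union>\<C>)\<^esub>}"
      using t by simp
  qed (auto simp: res nat zero)
  then show ?thesis
    using normalised_trace.kernel_submodule[OF nt] normalised_trace.kernel_splits[OF nt]
      scalar_section[OF A]
    by (simp add: splits_off_structure_sheaf_def submodule_sheaf_def)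
qed

definition splitting_trace ::
  "('p, 'a) ringed_space \<Rightarrow> ('p, 'a, 'b) module_sheaf \<Rightarrow> ('p set \<Rightarrow> 'b set) \<Rightarrow> 'p set \<Rightarrow> 'b \<Rightarrow> 'a"
  where "splitting_trace Z A S U a =
    split_algebra.scalar_part (sect Z U) (msect A U) (S U) a
      \<oplus>\<^bsub>sect Z U\<^esub> split_algebra.scalar_part (sect Z U) (msect A U) (S U) a"

lemma quaternion_trace_splitting_trace:
  assumes Z: "ringed_space Z" and A: "sheaf_of_algebras Z A" and S: "splits_off_structure_sheaf Z A S"
    and sq: "\<And>U x. openin (points Z) U \<Longrightarrow> x \<in> S U \<Longrightarrow>
      \<exists>g\<in>carrier (sect Z U). x \<otimes>\<^bsub>msect A U\<^esub> x = alg_unit A U g"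
    and two: "\<And>U. openin (points Z) U \<Longrightarrow>
      \<one>\<^bsub>sect Z U\<^esub> \<oplus>\<^bsub>sect Z U\<^esub> \<one>\<^bsub>sect Z U\<^esub> \<in> Units (sect Z U)"
  shows "quaternion_trace Z A (splitting_trace Z A S)"
proof -
  note sp = split_algebra_section[OF A S]
  \<comment> \<open>Restriction sends the summand \<open>S U\<close> into \<open>S V\<close> and
    scalars to scalars, so it carries the decomposition of \<open>a\<close> to a decomposition of
    its restriction; by uniqueness the scalar parts correspond.\<close>
  have nat: "splitting_trace Z A S V (mrest A U V a) = rest Z U V (splitting_trace Z A S U a)"
    if U: "openin (points Z) U" and V: "openin (points Z) V" and "V \<subseteq> U"
      and a: "a \<in> carrier (msect A U)" for U V a
  proof -
    interpret U: split_algebra "sect Z U" "msect A U" "S U" using sp[OF U] .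
    interpret V: split_algebra "sect Z V" "msect A V" "S V" using sp[OF V] .
    obtain f x where f: "f \<in> carrier (sect Z U)" "x \<in> S U" "a = U.scalar f \<oplus>\<^bsub>msect A U\<^esub> x"
      using U.decompose[OF a] by blast
    have h: "rest Z U V \<in> ring_hom (sect Z U) (sect Z V)"
      using Z U V \<open>V \<subseteq> U\<close> by (simp add: ringed_space_def)
    have h': "mrest A U V \<in> ring_hom (msect A U) (msect A V)"
      using A U V \<open>V \<subseteq> U\<close> by (simp add: sheaf_of_algebras_def)
    have "presheaf_of_sets (points Z) S (mrest A)"
      using S by (simp add: splits_off_structure_sheaf_def submodule_sheaf_def sheaf_of_sets_def)
    then have "mrest A U V x \<in> S V"
      using U V \<open>V \<subseteq> U\<close> f(2) by (rule presheaf_res_closed)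
    moreover have "mrest A U V (U.scalar f) = V.scalar (rest Z U V f)"
    proof -
      \<comment> \<open>Semilinearity of restriction moves f to \<open>rest Z U V f\<close>, and
        restriction, being a ring homomorphism, preserves the unit.\<close>
      have "mrest A U V (U.scalar f) = rest Z U V f \<odot>\<^bsub>msect A V\<^esub> mrest A U V \<one>\<^bsub>msect A U\<^esub>"
        using A U V \<open>V \<subseteq> U\<close> f(1) U.A.one_closed
        by (simp add: U.scalar_def sheaf_of_algebras_def sheaf_of_modules_def)
      then show ?thesis using ring_hom_one[OF h'] by (simp add: V.scalar_def)
    qed
    moreover have "rest Z U V f \<in> carrier (sect Z V)" using ring_hom_closed[OF h f(1)] .
    moreover have "mrest A U V a = mrest A U V (U.scalar f) \<oplus>\<^bsub>msect A V\<^esub> mrest A U V x"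
      unfolding f(3) using f(1,2) by (intro ring_hom_add[OF h']) simp_all
    ultimately have "V.scalar_part (mrest A U V a) = rest Z U V f"
      using V.scalar_part_eq by simp
    moreover have "U.scalar_part a = f" using f U.scalar_part_eq by simp
    ultimately show ?thesis
      using ring_hom_add[OF h f(1) f(1)] by (simp add: splitting_trace_def)
  qed
  have "module_sheaf_hom Z A (structure_module Z) (splitting_trace Z A S)"
    unfolding module_sheaf_hom_def
  proof (intro conjI allI impI)
    fix U assume U: "openin (points Z) U"
    interpret split_algebra "sect Z U" "msect A U" "S U" using sp[OF U] .
    show "splitting_trace Z A S U \<in> carrier (msect A U) \<rightarrow> carrier (msect (structure_module Z) U)"
      by (auto simp: splitting_trace_def structure_module_def scalar_part_closed)
    show "\<forall>a\<in>carrier (msect A U). \<forall>b\<in>carrier (msect A U).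
        splitting_trace Z A S U (a \<oplus>\<^bsub>msect A U\<^esub> b) = splitting_trace Z A S U a
          \<oplus>\<^bsub>msect (structure_module Z) U\<^esub> splitting_trace Z A S U b"
      by (simp add: splitting_trace_def structure_module_def scalar_part_closed
          scalar_part_add R.a_ac)
    show "\<forall>r\<in>carrier (sect Z U). \<forall>a\<in>carrier (msect A U).
        splitting_trace Z A S U (r \<odot>\<^bsub>msect A U\<^esub> a)
          = r \<odot>\<^bsub>msect (structure_module Z) U\<^esub> splitting_trace Z A S U a"
      by (simp add: splitting_trace_def structure_module_def scalar_part_closed
          scalar_part_smult R.r_distr)
  qed (simp add: nat structure_module_def)
  moreover have "half (sect Z U) \<otimes>\<^bsub>sect Z U\<^esub> splitting_trace Z A S U (alg_unit A U f) = f"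
    if U: "openin (points Z) U" and f: "f \<in> carrier (sect Z U)" for U f
  proof -
    interpret split_algebra "sect Z U" "msect A U" "S U" using sp[OF U] .
    show ?thesis
      using f by (simp add: splitting_trace_def scalar_section[OF A U, symmetric]
          scalar_part_scalar R.half_double[OF two[OF U]])
  qed
  moreover have "\<exists>g\<in>carrier (sect Z U). (a \<otimes>\<^bsub>msect A U\<^esub> a)
      \<ominus>\<^bsub>msect A U\<^esub> (splitting_trace Z A S U a \<odot>\<^bsub>msect A U\<^esub> a)
      \<oplus>\<^bsub>msect A U\<^esub> alg_unit A U g = \<zero>\<^bsub>msect A U\<^esub>"
    if U: "openin (points Z) U" and a: "a \<in> carrier (msect A U)" for U a
    using split_algebra.quadratic_of_square[OF sp[OF U] _ a] sq[OF U]
    by (simp add: splitting_trace_def scalar_section[OF A U])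
  ultimately show ?thesis by (simp add: quaternion_trace_def)
qed

text \<open>The empty family covers the empty set, so any two sections over it agree on every member
  of a cover, vacuously.\<close>

lemma sect_empty_trivial:
  assumes Z: "ringed_space Z"
  shows "carrier (sect Z {}) = {\<zero>\<^bsub>sect Z {}\<^esub>}"
proof -
  have F: "sheaf_of_sets (points Z) (\<lambda>U. carrier (sect Z U)) (rest Z)" and "cring (sect Z {})"
    using Z by (simp_all add: ringed_space_def)
  then interpret cring "sect Z {}" by simp
  have "a = \<zero>\<^bsub>sect Z {}\<^esub>" if "a \<in> carrier (sect Z {})" for a
    using sheaf_section_eqI[OF F, of "{}" a "\<zero>\<^bsub>sect Z {}\<^esub>"] that by simp
  then show ?thesis by blast
qed

text \<open>\<open>quaternion\<close> hides its trace behind an existential quantifier, so the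
  second half names the trace and ranges over every one that satisfies the definition.\<close>

theorem proposition4p3:
  fixes K :: "'k ring"
    and Z :: "('p, 'a) ringed_space"
    and \<pi> :: "'p \<Rightarrow> 'k set"
    and \<pi>s :: "'k set set \<Rightarrow> ('k set \<Rightarrow> ('k \<times> 'k) set) \<Rightarrow> 'a"
    and A :: "('p, 'a, 'b) module_sheaf"
  assumes "field K"
    and "\<one>\<^bsub>K\<^esub> \<oplus>\<^bsub>K\<^esub> \<one>\<^bsub>K\<^esub> \<noteq> \<zero>\<^bsub>K\<^esub>"
    and "noetherian_scheme Z"
    and "scheme_over_field K Z \<pi> \<pi>s"
    and "sheaf_of_algebras Z A"
    and "locally_free_of_rank Z A 4"
  shows "(quaternion Z A \<longleftrightarrow>
      (\<exists>S. splits_off_structure_sheaf Z A S \<and>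
        (\<forall>U. openin (points Z) U \<longrightarrow> (\<forall>x\<in>S U.
          \<exists>g\<in>carrier (sect Z U). x \<otimes>\<^bsub>msect A U\<^esub> x = alg_unit A U g)))) \<and>
    (integral_scheme Z \<longrightarrow> quaternion Z A \<longrightarrow>
      (\<forall>tr. quaternion_trace Z A tr \<longrightarrow>
        (\<forall>U. openin (points Z) U \<longrightarrow>
          (\<forall>x\<in>carrier (msect A U). \<forall>y\<in>carrier (msect A U).
            trace_pairing A tr U x y = trace_pairing A tr U y x)) \<and>
        cayley_hamilton_degree_two Z A tr))"
proof (intro conjI[of "_ \<longleftrightarrow> _"] iffI impI allI)
  note A = assms(5)
  note two = two_Units_sect[OF assms(1,2,4)]
  have Z: "ringed_space Z"
    using assms(4) by (simp add: scheme_over_field_def scheme_def locally_ringed_space_def)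
  {
    assume "quaternion Z A"
    then obtain tr where tr: "quaternion_trace Z A tr" by (auto simp: quaternion_def)
    have "\<exists>g\<in>carrier (sect Z U). x \<otimes>\<^bsub>msect A U\<^esub> x = alg_unit A U g"
      if U: "openin (points Z) U" and "x \<in> carrier (msect A U)" "tr U x = \<zero>\<^bsub>sect Z U\<^esub>" for U x
      using normalised_trace.kernel_square[OF normalised_trace_section[OF A tr U two[OF U]]] that
      by (simp add: scalar_section[OF A U])
    then show "\<exists>S. splits_off_structure_sheaf Z A S \<and>
        (\<forall>U. openin (points Z) U \<longrightarrow> (\<forall>x\<in>S U.
          \<exists>g\<in>carrier (sect Z U). x \<otimes>\<^bsub>msect A U\<^esub> x = alg_unit A U g))"
      using trace_kernel_splits_off[OF Z A tr two] by (intro exI conjI) auto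
  next
    assume "\<exists>S. splits_off_structure_sheaf Z A S \<and>
        (\<forall>U. openin (points Z) U \<longrightarrow> (\<forall>x\<in>S U.
          \<exists>g\<in>carrier (sect Z U). x \<otimes>\<^bsub>msect A U\<^esub> x = alg_unit A U g))"
    then obtain S where "splits_off_structure_sheaf Z A S"
      and "\<And>U x. openin (points Z) U \<Longrightarrow> x \<in> S U \<Longrightarrow>
          \<exists>g\<in>carrier (sect Z U). x \<otimes>\<^bsub>msect A U\<^esub> x = alg_unit A U g" by blast
    then show "quaternion Z A"
      using quaternion_trace_splitting_trace[OF Z A _ _ two] assms(6) A
      by (auto simp: quaternion_def)
  next
    fix tr assume int: "integral_scheme Z" and tr: "quaternion_trace Z A tr"
    have nt: "normalised_trace (sect Z U) (msect A U) (tr U)" if "openin (points Z) U" for U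
      using normalised_trace_section[OF A tr that two[OF that]] .
    have comm: "tr U (x \<otimes>\<^bsub>msect A U\<^esub> y) = tr U (y \<otimes>\<^bsub>msect A U\<^esub> x)"
      if U: "openin (points Z) U" and xy: "x \<in> carrier (msect A U)" "y \<in> carrier (msect A U)" for U x y
    proof -
      interpret normalised_trace "sect Z U" "msect A U" "tr U" using nt[OF U] .
      \<comment> \<open>Integrality gives domains only over nonempty open sets; over the empty set
        the ring of sections is zero.\<close>
      have "domain (sect Z U) \<or> carrier (sect Z U) = {\<zero>\<^bsub>sect Z U\<^esub>}"
        using int U sect_empty_trivial[OF Z] by (cases "U = {}") (simp_all add: integral_scheme_def)
      then show ?thesis using trace_mult_commute xy by blast
    qed
    then show "(\<forall>U. openin (points Z) U \<longrightarrow>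
          (\<forall>x\<in>carrier (msect A U). \<forall>y\<in>carrier (msect A U).
            trace_pairing A tr U x y = trace_pairing A tr U y x)) \<and>
        cayley_hamilton_degree_two Z A tr"
      using tr normalised_trace.tr_one[OF nt] normalised_trace.cayley_hamilton[OF nt]
        scalar_section[OF A]
      by (simp add: trace_pairing_def cayley_hamilton_degree_two_def quaternion_trace_def)
  }
qed

end
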